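(* Let $(\phi_t)_{t\ge 0}$ be a semigroup of holomorphic self-maps of $\mathbb{D}$ that is not a group. Suppose $\Delta$ is a hyperbolic petal of $(\phi_t)$ corresponding to the repelling fixed point $\sigma\in\partial\mathbb{D}$. Let $z\in\Delta$ and let $v_\Delta(t)=d_{\mathbb{D}}(z,\phi_t(z))$, $t\le 0$, be the total speed of $\Delta$. Then $$\lim_{t\to-\infty}\frac{v_\Delta(t)}{t}=\frac{\lambda}{2},$$ where $\lambda\in(-\infty,0)$ is the repelling spectral value of $(\phi_t)$ at $\sigma$.
   Context: $\mathbb{D}$ is the unit disk, and $d_{\mathbb{D}}(z,w)=\operatorname{arctanh}\left|\frac{z-w}{1-\bar z w}\right|$ is its hyperbolic distance. A semigroup in $\mathbb{D}$ is a family $(\phi_t)_{t\ge0}$ of holomorphic self-maps of $\mathbb{D}$ with $\phi_0=\mathrm{id}$, $\phi_{t+s}=\phi_t\circ\phi_s$ for all $t,s\ge0$, and $\phi_t(z)\to z$ uniformly on compacta as $t\to0^+$. It is a group if some (equivalently every) $\phi_{t_0}$, $t_0>0$, is an automorphism of $\mathbb{D}$. If it is not a group, there is a unique $\tau\in\overline{\mathbb{D}}$ (the Denjoy--Wolff point) with $\phi_t(z)\to\tau$ as $t\to+\infty$ for all $z\in\mathbb{D}$; the semigroup is elliptic if $\tau\in\mathbb{D}$ and non-elliptic if $\tau\in\partial\mathbb{D}$. A boundary fixed point is a point $\sigma\in\partial\mathbb{D}$ with $\angle\lim_{z\to\sigma}\phi_t(z)=\sigma$ for all $t\ge0$; it is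 regular if the angular derivative $\phi_t'(\sigma)$ is finite for all $t\ge0$. A repelling fixed point is a regular boundary fixed point different from $\tau$; its repelling spectral value is the $\lambda\in(-\infty,0)$ with $\phi_t'(\sigma)=e^{-\lambda t}$ for all $t\ge0$. The backward invariant set is $\mathcal{W}=\bigcap_{t\ge0}\phi_t(\mathbb{D})$. A petal is a non-empty connected component $\Delta$ of the interior of $\mathcal{W}$. Each $\phi_t$ ($t\ge 0$) restricts to an automorphism of $\Delta$; for $z\in\Delta$ and $t\le0$ one writes $\phi_t(z):=(\phi_{-t}|_\Delta)^{-1}(z)$. The curve $t\mapsto\phi_t(z)$, $t\le0$, is the backward orbit of $z$. A non-elliptic semigroup has a unique Koenigs function: a univalent holomorphic $h:\mathbb{D}\to\mathbb{C}$ with $h(0)=0$ and $h(\phi_t(z))=h(z)+t$ for all $z\in\mathbb D$, $t\ge0$. A petal $\Delta$ of a non-elliptic semigroup is hyperbolic if $h(\Delta)$ is a maximal horizontal strip in $h(\mathbb{D})$, and parabolic if $h(\Delta)$ is a maximal horizontal half-plane in $h(\mathbb{D})$ (one of the two always holds). Every petal of an elliptic semigroup is called hyperbolic. A hyperbolic petal $\Delta$ corresponds to the repelling fixed point $\sigma$ if all backward orbits in $\Delta$ converge to $\sigma$ as $t\to-\infty$. *)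

theory Defs
  imports "HOL-Complex_Analysis.Complex_Analysis"
begin

abbreviation unit_disc :: "complex set" where
  "unit_disc \<equiv> ball 0 1"

definition hyp_dist :: "complex \<Rightarrow> complex \<Rightarrow> real" where
  "hyp_dist z w = artanh (cmod ((z - w) / (1 - cnj z * w)))"

definition holo_automorphism :: "complex set \<Rightarrow> (complex \<Rightarrow> complex) \<Rightarrow> bool" where
  "holo_automorphism S f \<longleftrightarrow>
     f holomorphic_on S \<and> f ` S \<subseteq> S \<and>
     (\<exists>g. g holomorphic_on S \<and> g ` S \<subseteq> S \<and> (\<forall>z\<in>S. g (f z) = z) \<and> (\<forall>z\<in>S. f (g z) = z))"

(* Only the values phi t z with t \<ge> 0 and z in the unit disc are meaningful; all notions below
   depend on these values alone. *)
definition disc_semigroup :: "(real \<Rightarrow> complex \<Rightarrow> complex) \<Rightarrow> bool" where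
  "disc_semigroup \<phi> \<longleftrightarrow>
     (\<forall>t\<ge>0. \<phi> t holomorphic_on unit_disc \<and> \<phi> t ` unit_disc \<subseteq> unit_disc) \<and>
     (\<forall>z\<in>unit_disc. \<phi> 0 z = z) \<and>
     (\<forall>t\<ge>0. \<forall>s\<ge>0. \<forall>z\<in>unit_disc. \<phi> (t + s) z = \<phi> t (\<phi> s z)) \<and>
     (\<forall>K. compact K \<and> K \<subseteq> unit_disc \<longrightarrow> uniform_limit K \<phi> (\<lambda>z. z) (at_right 0))"

definition disc_group :: "(real \<Rightarrow> complex \<Rightarrow> complex) \<Rightarrow> bool" where
  "disc_group \<phi> \<longleftrightarrow> disc_semigroup \<phi> \<and> (\<exists>t>0. holo_automorphism unit_disc (\<phi> t))"

definition denjoy_wolff_point :: "(real \<Rightarrow> complex \<Rightarrow> complex) \<Rightarrow> complex \<Rightarrow> bool" where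
  "denjoy_wolff_point \<phi> \<tau> \<longleftrightarrow>
     \<tau> \<in> cball 0 1 \<and> (\<forall>z\<in>unit_disc. ((\<lambda>t. \<phi> t z) \<longlongrightarrow> \<tau>) at_top)"

lemma denjoy_wolff_point_unique:
  assumes "denjoy_wolff_point \<phi> \<tau>" "denjoy_wolff_point \<phi> \<tau>'"
  shows "\<tau> = \<tau>'"
proof -
  have "((\<lambda>t. \<phi> t 0) \<longlongrightarrow> \<tau>) at_top" "((\<lambda>t. \<phi> t 0) \<longlongrightarrow> \<tau>') at_top"
    using assms by (auto simp: denjoy_wolff_point_def)
  then show ?thesis
    by (rule tendsto_unique[OF trivial_limit_at_top_linorder])
qed

(* The elliptic / non-elliptic dichotomy is meant for semigroups that are not groups. *)
definition elliptic :: "(real \<Rightarrow> complex \<Rightarrow> complex) \<Rightarrow> bool" where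
  "elliptic \<phi> \<longleftrightarrow> (\<exists>\<tau>. denjoy_wolff_point \<phi> \<tau> \<and> \<tau> \<in> unit_disc)"

definition non_elliptic :: "(real \<Rightarrow> complex \<Rightarrow> complex) \<Rightarrow> bool" where
  "non_elliptic \<phi> \<longleftrightarrow> (\<exists>\<tau>. denjoy_wolff_point \<phi> \<tau> \<and> \<tau> \<in> sphere 0 1)"

definition stolz_region :: "complex \<Rightarrow> real \<Rightarrow> complex set" where
  "stolz_region \<sigma> M = {z \<in> unit_disc. cmod (\<sigma> - z) < M * (1 - cmod z)}"

(* Non-tangential limit at a point of the unit circle; for M \<le> 1 the Stolz region is empty. *)
definition has_angular_limit :: "(complex \<Rightarrow> complex) \<Rightarrow> complex \<Rightarrow> complex \<Rightarrow> bool" where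
  "has_angular_limit f \<sigma> l \<longleftrightarrow> (\<forall>M>1. (f \<longlongrightarrow> l) (at \<sigma> within stolz_region \<sigma> M))"

(* Finite angular derivative of f at a boundary fixed point \<sigma>, so that the boundary value
   f(\<sigma>) in the difference quotient is \<sigma> itself. *)
definition has_angular_deriv_fixed :: "(complex \<Rightarrow> complex) \<Rightarrow> complex \<Rightarrow> complex \<Rightarrow> bool" where
  "has_angular_deriv_fixed f \<sigma> d \<longleftrightarrow> has_angular_limit (\<lambda>z. (f z - \<sigma>) / (z - \<sigma>)) \<sigma> d"

definition boundary_fixed_point :: "(real \<Rightarrow> complex \<Rightarrow> complex) \<Rightarrow> complex \<Rightarrow> bool" where
  "boundary_fixed_point \<phi> \<sigma> \<longleftrightarrow> \<sigma> \<in> sphere 0 1 \<and> (\<forall>t\<ge>0. has_angular_limit (\<phi> t) \<sigma> \<sigma>)"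

definition regular_boundary_fixed_point :: "(real \<Rightarrow> complex \<Rightarrow> complex) \<Rightarrow> complex \<Rightarrow> bool" where
  "regular_boundary_fixed_point \<phi> \<sigma> \<longleftrightarrow>
     boundary_fixed_point \<phi> \<sigma> \<and> (\<forall>t\<ge>0. \<exists>d. has_angular_deriv_fixed (\<phi> t) \<sigma> d)"

definition repelling_fixed_point :: "(real \<Rightarrow> complex \<Rightarrow> complex) \<Rightarrow> complex \<Rightarrow> bool" where
  "repelling_fixed_point \<phi> \<sigma> \<longleftrightarrow>
     regular_boundary_fixed_point \<phi> \<sigma> \<and> \<not> denjoy_wolff_point \<phi> \<sigma>"

definition repelling_spectral_value ::
    "(real \<Rightarrow> complex \<Rightarrow> complex) \<Rightarrow> complex \<Rightarrow> real \<Rightarrow> bool" where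
  "repelling_spectral_value \<phi> \<sigma> \<mu> \<longleftrightarrow>
     \<mu> < 0 \<and> (\<forall>t\<ge>0. has_angular_deriv_fixed (\<phi> t) \<sigma> (of_real (exp (- \<mu> * t))))"

definition backward_invariant_set :: "(real \<Rightarrow> complex \<Rightarrow> complex) \<Rightarrow> complex set" where
  "backward_invariant_set \<phi> = (\<Inter>t\<in>{0..}. \<phi> t ` unit_disc)"

definition petal :: "(real \<Rightarrow> complex \<Rightarrow> complex) \<Rightarrow> complex set \<Rightarrow> bool" where
  "petal \<phi> \<Delta> \<longleftrightarrow> \<Delta> \<in> components (interior (backward_invariant_set \<phi>))"

(* For t < 0 this uses that phi (-t) restricts to a bijection of the petal. *)
definition petal_flow ::
    "(real \<Rightarrow> complex \<Rightarrow> complex) \<Rightarrow> complex set \<Rightarrow> real \<Rightarrow> complex \<Rightarrow> complex" where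
  "petal_flow \<phi> \<Delta> t z = (if t \<ge> 0 then \<phi> t z else inv_into \<Delta> (\<phi> (- t)) z)"

definition koenigs_function ::
    "(real \<Rightarrow> complex \<Rightarrow> complex) \<Rightarrow> (complex \<Rightarrow> complex) \<Rightarrow> bool" where
  "koenigs_function \<phi> h \<longleftrightarrow>
     h holomorphic_on unit_disc \<and> inj_on h unit_disc \<and> h 0 = 0 \<and>
     (\<forall>z\<in>unit_disc. \<forall>t\<ge>0. h (\<phi> t z) = h z + of_real t)"

definition horizontal_strip :: "complex set \<Rightarrow> bool" where
  "horizontal_strip S \<longleftrightarrow> (\<exists>a b :: real. a < b \<and> S = {w. a < Im w \<and> Im w < b})"

definition maximal_horizontal_strip :: "complex set \<Rightarrow> complex set \<Rightarrow> bool" where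
  "maximal_horizontal_strip \<Omega> S \<longleftrightarrow>
     horizontal_strip S \<and> S \<subseteq> \<Omega> \<and>
     (\<forall>S'. horizontal_strip S' \<and> S' \<subseteq> \<Omega> \<and> S \<subseteq> S' \<longrightarrow> S' = S)"

definition hyperbolic_petal :: "(real \<Rightarrow> complex \<Rightarrow> complex) \<Rightarrow> complex set \<Rightarrow> bool" where
  "hyperbolic_petal \<phi> \<Delta> \<longleftrightarrow>
     petal \<phi> \<Delta> \<and>
     (elliptic \<phi> \<or>
      non_elliptic \<phi> \<and>
        (\<exists>h. koenigs_function \<phi> h \<and> maximal_horizontal_strip (h ` unit_disc) (h ` \<Delta>)))"

definition corresponds_to ::
    "(real \<Rightarrow> complex \<Rightarrow> complex) \<Rightarrow> complex set \<Rightarrow> complex \<Rightarrow> bool" where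
  "corresponds_to \<phi> \<Delta> \<sigma> \<longleftrightarrow> (\<forall>z\<in>\<Delta>. ((\<lambda>t. petal_flow \<phi> \<Delta> t z) \<longlongrightarrow> \<sigma>) at_bot)"

definition total_speed ::
    "(real \<Rightarrow> complex \<Rightarrow> complex) \<Rightarrow> complex set \<Rightarrow> complex \<Rightarrow> real \<Rightarrow> real" where
  "total_speed \<phi> \<Delta> z t = hyp_dist z (petal_flow \<phi> \<Delta> t z)"

end

theory Submission
  imports Defs
begin

text \<open>
  Put \<open>w\<^sub>n = \<phi>\<^bsub>-n\<delta>\<^esub>(z)\<close> for a fixed step \<open>\<delta> > 0\<close>. This is a backward iteration sequence of the
  self-map \<open>f = \<phi>\<^bsub>\<delta>\<^esub>\<close>, that is \<open>f(w\<^bsub>n+1\<^esub>) = w\<^sub>n\<close>, and it converges to \<open>\<sigma>\<close>, where \<open>f\<close> has angular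
  derivative \<open>\<alpha> = exp(-\<mu>\<delta>) > 1\<close>. If \<open>w\<^sub>n\<close> approaches \<open>\<sigma>\<close> inside a Stolz region, the theorem is
  immediate: the difference quotients \<open>(f(w\<^bsub>n+1\<^esub>) - \<sigma>)/(w\<^bsub>n+1\<^esub> - \<sigma>) = (w\<^sub>n - \<sigma>)/(w\<^bsub>n+1\<^esub> - \<sigma>)\<close> tend to \<open>\<alpha>\<close>,
  so \<open>-ln |w\<^sub>n - \<sigma>|\<close> grows like \<open>n ln \<alpha>\<close>; in a Stolz region \<open>|w\<^sub>n - \<sigma>|\<close> is comparable to
  \<open>1 - |w\<^sub>n|\<close>, so the hyperbolic distance from \<open>0\<close> to \<open>w\<^sub>n\<close> is \<open>-(1/2) ln |w\<^sub>n - \<sigma>|\<close> up to a bounded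
  error and grows like \<open>(n/2) ln \<alpha> = -n\<delta>\<mu>/2\<close>. Replacing the origin by \<open>z\<close>,
  and the times \<open>-n\<delta>\<close> by the real times between them, changes the distance by a bounded amount.

  The point is therefore the non-tangential approach, which rests on two facts. First, the proof
  of Julia's lemma shows that \<open>1 - |f(w)|\<^sup>2\<close> eventually exceeds \<open>A (1 - |w|\<^sup>2)\<close>, for any fixed
  \<open>A < \<alpha>\<close>, along every sequence \<open>w \<rightarrow> \<sigma>\<close> with \<open>f(w) \<rightarrow> \<sigma>\<close>, however tangential
  (\<open>julia_eventually_ratio\<close>). With \<open>A > 1\<close> this makes \<open>1 - |w\<^sub>n|\<^sup>2\<close> decay geometrically. Second, the
  hyperbolic steps from \<open>w\<^sub>n\<close> to \<open>w\<^bsub>n+1\<^esub>\<close> are bounded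
  (\<open>petal_flow_backward_hyp_dist_bounded\<close>), so \<open>|w\<^sub>n - w\<^bsub>n+1\<^esub>|\<close> is at most a constant times
  \<open>1 - |w\<^sub>n|\<^sup>2\<close>. Summing the geometric series bounds \<open>|w\<^sub>n - \<sigma>|\<close> by a constant times \<open>1 - |w\<^sub>n|\<close>,
  which is the Stolz condition (\<open>stolz_approach_of_geometric_decay\<close>).

  The steps are bounded because the backward flow is a family of holomorphic maps from the petal
  into the disc: on a disc contained in the petal all of them contract by the Schwarz-Pick lemma,
  and any two points of the connected petal are joined by a finite chain of such discs. That
  backward time is well defined on the petal needs the univalence of \<open>\<phi>\<^sub>t\<close>
  (\<open>semigroup_inj_on\<close>) and the invariance of the petal (\<open>mem_petal_iff\<close>).
\<close>

section \<open>The hyperbolic distance of the disc\<close>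

definition pseudohyp_dist :: "complex \<Rightarrow> complex \<Rightarrow> real" where
  "pseudohyp_dist z w = cmod ((z - w) / (1 - cnj z * w))"

lemma hyp_dist_eq: "hyp_dist z w = artanh (pseudohyp_dist z w)"
  by (simp add: hyp_dist_def pseudohyp_dist_def)

lemma one_minus_cnj_mult_nonzero:
  assumes "cmod z < 1" "cmod w < 1"
  shows "1 - cnj z * w \<noteq> 0"
proof
  assume "1 - cnj z * w = 0"
  then have "cmod (cnj z * w) = 1"
    by simp
  moreover have "cmod (cnj z * w) < 1"
    using norm_mult_less[of "cnj z" 1 w 1] assms by simp
  ultimately show False by simp
qed

lemma norm_one_minus_cnj_mult_commute: "cmod (1 - cnj z * w) = cmod (1 - cnj w * z)"
proof -
  have "cnj (1 - cnj z * w) = 1 - cnj w * z" by (simp add: mult.commute)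
  then show ?thesis by (metis complex_mod_cnj)
qed

lemma pseudohyp_dist_commute: "pseudohyp_dist z w = pseudohyp_dist w z"
  unfolding pseudohyp_dist_def norm_divide
  using norm_one_minus_cnj_mult_commute[of z w] by (simp add: norm_minus_commute)

lemma hyp_dist_commute: "hyp_dist z w = hyp_dist w z"
  by (simp add: hyp_dist_eq pseudohyp_dist_commute)

lemma disc_norm_identity:
  "(cmod (1 - cnj z * w))\<^sup>2 - (cmod (z - w))\<^sup>2 = (1 - (cmod z)\<^sup>2) * (1 - (cmod w)\<^sup>2)"
  unfolding cmod_power2 by (simp add: algebra_simps power2_eq_square)

lemma one_minus_pseudohyp_dist_square:
  assumes "cmod z < 1" "cmod w < 1"
  shows "1 - (pseudohyp_dist z w)\<^sup>2 =
    (1 - (cmod z)\<^sup>2) * (1 - (cmod w)\<^sup>2) / (cmod (1 - cnj z * w))\<^sup>2"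
  using one_minus_cnj_mult_nonzero[OF assms] disc_norm_identity[of z w]
  by (simp add: pseudohyp_dist_def norm_divide power_divide divide_simps)

lemma pseudohyp_dist_nonneg [simp]: "0 \<le> pseudohyp_dist z w"
  by (simp add: pseudohyp_dist_def)

lemma one_minus_norm_square_pos:
  fixes z :: complex
  assumes "cmod z < 1"
  shows "0 < 1 - (cmod z)\<^sup>2"
  using assms by (simp add: power_less_one_iff abs_square_less_1)

lemma pseudohyp_dist_less_1:
  assumes "cmod z < 1" "cmod w < 1"
  shows "pseudohyp_dist z w < 1"
proof -
  have "0 < 1 - (pseudohyp_dist z w)\<^sup>2"
    unfolding one_minus_pseudohyp_dist_square[OF assms]
    using one_minus_cnj_mult_nonzero[OF assms] one_minus_norm_square_pos assms by simp
  then show ?thesis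
    by (metis abs_square_less_1 diff_gt_0_iff_gt abs_of_nonneg pseudohyp_dist_nonneg)
qed

lemma pseudohyp_dist_eq_Moebius: "pseudohyp_dist z w = cmod (Moebius_function 0 z w)"
  by (simp add: pseudohyp_dist_def Moebius_function_simple norm_divide norm_minus_commute)

text \<open>
  Moebius maps move \<open>z\<close> and \<open>f z\<close> to the origin, where the Schwarz lemma applies.
\<close>
theorem schwarz_pick:
  assumes hol: "f holomorphic_on unit_disc" and im: "f ` unit_disc \<subseteq> unit_disc"
    and z: "cmod z < 1" and w: "cmod w < 1"
  shows "pseudohyp_dist (f z) (f w) \<le> pseudohyp_dist z w"
proof -
  have fz: "cmod (f z) < 1"
    using im z by (auto simp: image_subset_iff)
  \<comment> \<open>\<open>F\<close> fixes the origin, and maps the Moebius image of \<open>w\<close> to that of \<open>f w\<close>.\<close>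
  define F where "F = Moebius_function 0 (f z) \<circ> f \<circ> Moebius_function 0 (- z)"
  define \<xi> where "\<xi> = Moebius_function 0 z w"
  have M1: "Moebius_function 0 (- z) ` unit_disc \<subseteq> unit_disc"
    using Moebius_function_norm_lt_1[of "- z"] z by auto
  have "F holomorphic_on unit_disc"
    unfolding F_def
    using Moebius_function_holomorphic[of "- z" 0] Moebius_function_holomorphic[of "f z" 0] z fz M1 im hol
    by (intro holomorphic_on_compose_gen[where t = unit_disc]) auto
  moreover have "F 0 = 0"
    by (simp add: F_def Moebius_function_of_zero Moebius_function_eq_zero)
  moreover have "cmod (F x) < 1" if "cmod x < 1" for x
    unfolding F_def using that M1 im fz
    by (auto intro!: Moebius_function_norm_lt_1 simp: image_subset_iff)
  moreover have "cmod \<xi> < 1"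
    unfolding \<xi>_def using z w by (rule Moebius_function_norm_lt_1)
  ultimately have "cmod (F \<xi>) \<le> cmod \<xi>"
    by (rule Schwarz_Lemma(1))
  moreover have "F \<xi> = Moebius_function 0 (f z) (f w)"
    using Moebius_function_compose[of "- z" z w] z w by (simp add: F_def \<xi>_def)
  ultimately show ?thesis
    by (simp add: pseudohyp_dist_eq_Moebius \<xi>_def)
qed

lemma artanh_mono_real:
  fixes x y :: real
  assumes "0 \<le> x" "x \<le> y" "y < 1"
  shows "artanh x \<le> artanh y"
proof -
  have "(1 + x) / (1 - x) \<le> (1 + y) / (1 - y)"
    using assms by (intro frac_le) auto
  then show ?thesis
    using assms by (simp add: artanh_def)
qed

lemma artanh_nonneg_real: "0 \<le> artanh x" if "0 \<le> x" "x < 1" for x :: real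
  using artanh_mono_real[of 0 x] that by simp

lemma artanh_add_real:
  fixes x y :: real
  assumes "0 \<le> x" "x < 1" "0 \<le> y" "y < 1"
  shows "(x + y) / (1 + x * y) < 1"
    and "artanh x + artanh y = artanh ((x + y) / (1 + x * y))"
proof -
  define s where "s = (x + y) / (1 + x * y)"
  have pos: "0 < 1 + x * y" "0 < (1 - x) * (1 - y)"
    using assms by (auto intro: add_pos_nonneg)
  have s: "1 + s = (1 + x) * (1 + y) / (1 + x * y)" "1 - s = (1 - x) * (1 - y) / (1 + x * y)"
    using pos by (auto simp: s_def field_simps)
  have "(1 + s) / (1 - s) = ((1 + x) / (1 - x)) * ((1 + y) / (1 - y))"
    unfolding s using pos by simp
  moreover have "0 < 1 - s"
    unfolding s(2) using pos by simp
  ultimately show "(x + y) / (1 + x * y) < 1"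
    and "artanh x + artanh y = artanh ((x + y) / (1 + x * y))"
    using assms by (simp_all add: artanh_def s_def[symmetric] ln_mult del: mult_divide_mult_cancel_right times_divide_eq_left times_divide_eq_right)
qed

lemma hyp_dist_mono_pseudohyp_dist:
  assumes "cmod z < 1" "cmod w < 1" "cmod z' < 1" "cmod w' < 1"
    and "pseudohyp_dist z w \<le> pseudohyp_dist z' w'"
  shows "hyp_dist z w \<le> hyp_dist z' w'"
  using assms by (auto simp: hyp_dist_eq intro!: artanh_mono_real pseudohyp_dist_less_1)

lemma hyp_dist_contraction:
  assumes "f holomorphic_on unit_disc" "f ` unit_disc \<subseteq> unit_disc" "cmod z < 1" "cmod w < 1"
  shows "hyp_dist (f z) (f w) \<le> hyp_dist z w"
  using schwarz_pick[OF assms] assms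
  by (intro hyp_dist_mono_pseudohyp_dist) (auto simp: image_subset_iff)

lemma hyp_dist_nonneg:
  assumes "cmod z < 1" "cmod w < 1"
  shows "0 \<le> hyp_dist z w"
  using assms by (simp add: hyp_dist_eq artanh_nonneg_real pseudohyp_dist_less_1)

text \<open>
  The triangle inequality through the origin: the identity for \<open>1 - (pseudohyp_dist z w)\<^sup>2\<close> and
  \<open>|1 - cnj z * w| \<le> 1 + |z||w|\<close> bound the pseudohyperbolic distance by
  \<open>(|z| + |w|)/(1 + |z||w|)\<close>, and this is the addition formula of \<open>artanh\<close>.
\<close>
lemma hyp_dist_triangle_0:
  assumes "cmod z < 1" "cmod w < 1"
  shows "hyp_dist z w \<le> artanh (cmod z) + artanh (cmod w)"
proof -
  define x y where "x = cmod z" and "y = cmod w"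
  have xy: "0 \<le> x" "x < 1" "0 \<le> y" "y < 1"
    using assms by (auto simp: x_def y_def)
  have pos: "0 < 1 + x * y"
    using xy by (intro add_pos_nonneg) auto
  have D: "0 < cmod (1 - cnj z * w)"
    using one_minus_cnj_mult_nonzero[OF assms] by simp
  have "cmod (1 - cnj z * w) \<le> 1 + x * y"
    using norm_triangle_ineq4[of 1 "cnj z * w"] by (simp add: x_def y_def norm_mult)
  then have "(cmod (1 - cnj z * w))\<^sup>2 \<le> (1 + x * y)\<^sup>2"
    using D by (intro power_mono) auto
  then have "(1 - x\<^sup>2) * (1 - y\<^sup>2) / (1 + x * y)\<^sup>2
      \<le> (1 - x\<^sup>2) * (1 - y\<^sup>2) / (cmod (1 - cnj z * w))\<^sup>2"
    using assms D pos one_minus_norm_square_pos[OF assms(1)] one_minus_norm_square_pos[OF assms(2)]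
    by (intro divide_left_mono) (auto simp: x_def y_def)
  also have "\<dots> = 1 - (pseudohyp_dist z w)\<^sup>2"
    using one_minus_pseudohyp_dist_square[OF assms] by (simp add: x_def y_def)
  finally have "(pseudohyp_dist z w)\<^sup>2 \<le> 1 - (1 - x\<^sup>2) * (1 - y\<^sup>2) / (1 + x * y)\<^sup>2"
    by simp
  also have "\<dots> = ((x + y) / (1 + x * y))\<^sup>2"
    using pos by (simp add: field_simps) (simp add: algebra_simps power2_eq_square)
  finally have "pseudohyp_dist z w \<le> (x + y) / (1 + x * y)"
    using xy pos by (auto intro: power2_le_imp_le)
  then have "artanh (pseudohyp_dist z w) \<le> artanh ((x + y) / (1 + x * y))"
    using artanh_add_real(1)[OF xy] by (intro artanh_mono_real) auto
  then show ?thesis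
    using artanh_add_real(2)[OF xy] by (simp add: hyp_dist_eq x_def y_def)
qed

lemma hyp_dist_zero_left: "hyp_dist 0 w = artanh (cmod w)"
  by (simp add: hyp_dist_def)

text \<open>
  A Moebius map and its inverse both contract, so they are isometries and the middle point may be
  moved to the origin.
\<close>
theorem hyp_dist_triangle:
  assumes z: "cmod z < 1" and u: "cmod u < 1" and w: "cmod w < 1"
  shows "hyp_dist z w \<le> hyp_dist z u + hyp_dist u w"
proof -
  define M where "M = Moebius_function 0 u"
  define N where "N = Moebius_function 0 (- u)"
  have N: "N holomorphic_on unit_disc" "N ` unit_disc \<subseteq> unit_disc"
    using Moebius_function_holomorphic[of "- u"] Moebius_function_norm_lt_1[of "- u"] u
    by (auto simp: N_def)
  have M: "cmod (M x) < 1" "N (M x) = x" if "cmod x < 1" for x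
    using Moebius_function_norm_lt_1[of u] Moebius_function_compose[of "- u" u x] u that
    by (auto simp: M_def N_def)
  have "hyp_dist z w = hyp_dist (N (M z)) (N (M w))"
    using M z w by simp
  also have "\<dots> \<le> hyp_dist (M z) (M w)"
    using N M z w by (intro hyp_dist_contraction) auto
  also have "\<dots> \<le> artanh (cmod (M z)) + artanh (cmod (M w))"
    using M z w by (intro hyp_dist_triangle_0) auto
  also have "\<dots> = hyp_dist z u + hyp_dist u w"
    unfolding hyp_dist_commute[of z u] by (simp add: hyp_dist_eq pseudohyp_dist_eq_Moebius M_def)
  finally show ?thesis .
qed

lemma norm_diff_le_pseudohyp_dist:
  assumes "cmod z < 1" "cmod w < 1"
  shows "cmod (z - w) \<le> 2 * pseudohyp_dist z w"
proof -
  have "cmod (cnj z * w) \<le> 1"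
    using assms by (simp add: norm_mult mult_le_one)
  then have "cmod (1 - cnj z * w) \<le> 2"
    using norm_triangle_ineq4[of 1 "cnj z * w"] by simp
  then have "pseudohyp_dist z w * cmod (1 - cnj z * w) \<le> pseudohyp_dist z w * 2"
    by (intro mult_left_mono) auto
  then show ?thesis
    using one_minus_cnj_mult_nonzero[OF assms] by (simp add: pseudohyp_dist_def norm_divide mult.commute)
qed

lemma schwarz_pick_ball:
  assumes hol: "f holomorphic_on ball a r" and im: "f ` ball a r \<subseteq> unit_disc"
    and x: "x \<in> ball a r"
  shows "hyp_dist (f a) (f x) \<le> artanh (cmod (x - a) / r)"
proof -
  have r: "0 < r"
    using x by (metis mem_ball dist_pos_lt dual_order.strict_trans zero_le_dist le_less_trans)
  define g where "g = f \<circ> (\<lambda>\<zeta>. a + of_real r * \<zeta>)"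
  have sub: "(\<lambda>\<zeta>. a + of_real r * \<zeta>) ` unit_disc \<subseteq> ball a r"
    using r by (auto simp: dist_norm norm_mult)
  have "g holomorphic_on unit_disc"
    unfolding g_def using sub hol
    by (intro holomorphic_on_compose_gen[where t = "ball a r"] holomorphic_intros) auto
  moreover have "g ` unit_disc \<subseteq> unit_disc"
    using sub im by (auto simp: g_def image_subset_iff)
  moreover have "cmod ((x - a) / of_real r) < 1"
    using x r by (simp add: norm_divide dist_norm norm_minus_commute)
  ultimately have "hyp_dist (g 0) (g ((x - a) / of_real r)) \<le> hyp_dist 0 ((x - a) / of_real r)"
    by (intro hyp_dist_contraction) auto
  then show ?thesis
    using r by (simp add: g_def hyp_dist_zero_left norm_divide)
qed

section \<open>Expansion at a boundary fixed point\<close>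

text \<open>
  The Schwarz-Pick inequality in a form that survives the limit of \<open>w\<close> and \<open>f w\<close> to the unit
  circle.
\<close>
lemma schwarz_pick_boundary_form:
  assumes "f holomorphic_on unit_disc" "f ` unit_disc \<subseteq> unit_disc" "cmod z < 1" "cmod w < 1"
  shows "(cmod (1 - cnj (f w) * f z))\<^sup>2 * ((1 - (cmod z)\<^sup>2) * (1 - (cmod w)\<^sup>2)) \<le>
    (cmod (1 - cnj w * z))\<^sup>2 * ((1 - (cmod (f z))\<^sup>2) * (1 - (cmod (f w))\<^sup>2))"
proof -
  have f: "cmod (f z) < 1" "cmod (f w) < 1"
    using assms by (auto simp: image_subset_iff)
  have "(pseudohyp_dist (f w) (f z))\<^sup>2 \<le> (pseudohyp_dist w z)\<^sup>2"
    using schwarz_pick[OF assms(1,2,4,3)] by (intro power_mono) auto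
  then have "1 - (pseudohyp_dist w z)\<^sup>2 \<le> 1 - (pseudohyp_dist (f w) (f z))\<^sup>2"
    by simp
  then show ?thesis
    using one_minus_cnj_mult_nonzero[OF assms(4,3)] one_minus_cnj_mult_nonzero[OF f(2,1)]
    unfolding one_minus_pseudohyp_dist_square[OF assms(4,3)] one_minus_pseudohyp_dist_square[OF f(2,1)]
    by (simp add: field_simps)
qed

lemma norm_one_minus_cnj_unit:
  assumes "cmod \<sigma> = 1"
  shows "cmod (1 - cnj \<sigma> * u) = cmod (\<sigma> - u)"
proof -
  have "cnj \<sigma> * \<sigma> = 1"
    using assms complex_norm_square[of \<sigma>] by (simp add: mult.commute)
  then have "1 - cnj \<sigma> * u = cnj \<sigma> * (\<sigma> - u)"
    by (simp add: algebra_simps)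
  then show ?thesis
    using assms by (simp add: norm_mult)
qed

lemma filterlim_radius_stolz:
  assumes \<sigma>: "cmod \<sigma> = 1"
  shows "filterlim (\<lambda>r. of_real r * \<sigma>) (at \<sigma> within stolz_region \<sigma> 2) (at_left (1::real))"
proof -
  have "((\<lambda>r. complex_of_real r * \<sigma>) \<longlongrightarrow> of_real 1 * \<sigma>) (at_left 1)"
    by (intro tendsto_intros)
  moreover have "\<forall>\<^sub>F r in at_left (1::real). of_real r * \<sigma> \<in> stolz_region \<sigma> 2 \<and> of_real r * \<sigma> \<noteq> \<sigma>"
  proof -
    have "\<forall>\<^sub>F r in at_left (1::real). 0 < r \<and> r < 1"
      using eventually_at_left_real[of 0 1] by (auto elim: eventually_mono)
    then show ?thesis
    proof (eventually_elim)
      case (elim r)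
      have "\<sigma> - of_real r * \<sigma> = of_real (1 - r) * \<sigma>"
        by (simp add: algebra_simps)
      then have "cmod (\<sigma> - of_real r * \<sigma>) = 1 - r"
        using elim \<sigma> by (simp add: norm_mult del: of_real_diff)
      then show ?case
        using elim \<sigma> by (auto simp: stolz_region_def norm_mult)
    qed
  qed
  ultimately show ?thesis
    by (auto simp: filterlim_at)
qed

text \<open>
  If the ratio were at most \<open>A\<close> infinitely often, the Schwarz-Pick inequality would pass to the
  limit along these indices and give Julia's inequality at \<open>\<sigma>\<close> with constant \<open>A\<close>. Evaluated
  on the radius to \<open>\<sigma>\<close>, where the difference quotient tends to \<open>d\<close>, it would force
  \<open>|d| \<le> A\<close>. The sequence itself may approach \<open>\<sigma>\<close> tangentially.
\<close>
theorem julia_eventually_ratio: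
  fixes w :: "nat \<Rightarrow> complex"
  assumes hol: "f holomorphic_on unit_disc" and im: "f ` unit_disc \<subseteq> unit_disc"
    and \<sigma>: "cmod \<sigma> = 1"
    and d: "has_angular_deriv_fixed f \<sigma> d"
    and w: "\<And>n. cmod (w n) < 1" and wlim: "w \<longlonglongrightarrow> \<sigma>" and fwlim: "(\<lambda>n. f (w n)) \<longlonglongrightarrow> \<sigma>"
    and A: "0 < A" "A < cmod d"
  shows "\<forall>\<^sub>F n in sequentially. A * (1 - (cmod (w n))\<^sup>2) < 1 - (cmod (f (w n)))\<^sup>2"
proof (rule ccontr)
  assume "\<not> ?thesis"
  then have freq: "\<exists>\<^sub>F n in sequentially. 1 - (cmod (f (w n)))\<^sup>2 \<le> A * (1 - (cmod (w n))\<^sup>2)"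
    by (simp add: not_eventually not_less)
  have f1: "cmod (f z) < 1" if "cmod z < 1" for z
    using im that by (auto simp: image_subset_iff)
  \<comment> \<open>Julia's inequality at \<open>\<sigma>\<close> with constant \<open>A\<close>\<close>
  have julia: "(cmod (\<sigma> - f z))\<^sup>2 * (1 - (cmod z)\<^sup>2) \<le> A * (cmod (\<sigma> - z))\<^sup>2 * (1 - (cmod (f z))\<^sup>2)"
    if z: "cmod z < 1" for z
  proof (rule ccontr)
    define L where "L n = (cmod (1 - cnj (f (w n)) * f z))\<^sup>2 * (1 - (cmod z)\<^sup>2)" for n
    define R where "R n = A * (cmod (1 - cnj (w n) * z))\<^sup>2 * (1 - (cmod (f z))\<^sup>2)" for n
    assume neg: "\<not> ?thesis"
    have lim: "(\<lambda>n. L n - R n) \<longlonglongrightarrow>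
        (cmod (1 - cnj \<sigma> * f z))\<^sup>2 * (1 - (cmod z)\<^sup>2) - A * (cmod (1 - cnj \<sigma> * z))\<^sup>2 * (1 - (cmod (f z))\<^sup>2)"
      unfolding L_def R_def by (intro tendsto_intros wlim fwlim)
    have "\<forall>\<^sub>F n in sequentially. 0 < L n - R n"
      by (rule order_tendstoD(1)[OF lim]) (use neg in \<open>simp add: norm_one_minus_cnj_unit[OF \<sigma>]\<close>)
    with freq have "\<exists>\<^sub>F n in sequentially. 1 - (cmod (f (w n)))\<^sup>2 \<le> A * (1 - (cmod (w n))\<^sup>2) \<and> 0 < L n - R n"
      by (rule frequently_eventually_frequently)
    then obtain n where n: "0 < L n - R n" "1 - (cmod (f (w n)))\<^sup>2 \<le> A * (1 - (cmod (w n))\<^sup>2)"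
      by (auto dest: frequently_ex)
    have pos: "0 < 1 - (cmod (w n))\<^sup>2" "0 < 1 - (cmod (f z))\<^sup>2"
      using one_minus_norm_square_pos w f1 z by auto
    have "L n * (1 - (cmod (w n))\<^sup>2) \<le>
        (cmod (1 - cnj (w n) * z))\<^sup>2 * ((1 - (cmod (f z))\<^sup>2) * (1 - (cmod (f (w n)))\<^sup>2))"
      using schwarz_pick_boundary_form[OF hol im z w] by (simp add: L_def mult_ac)
    also have "\<dots> \<le> (cmod (1 - cnj (w n) * z))\<^sup>2 * ((1 - (cmod (f z))\<^sup>2) * (A * (1 - (cmod (w n))\<^sup>2)))"
      using n pos by (intro mult_left_mono) auto
    also have "\<dots> = R n * (1 - (cmod (w n))\<^sup>2)"
      by (simp add: R_def mult_ac)
    finally have "L n \<le> R n"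
      using pos by simp
    then show False
      using n by simp
  qed
  have "((\<lambda>r. cmod ((f (of_real r * \<sigma>) - \<sigma>) / (of_real r * \<sigma> - \<sigma>))) \<longlongrightarrow> cmod d) (at_left 1)"
    using d unfolding has_angular_deriv_fixed_def has_angular_limit_def
    by (intro tendsto_norm filterlim_compose[OF _ filterlim_radius_stolz[OF \<sigma>]]) auto
  moreover have "((\<lambda>r::real. 2 * A / (1 + r)) \<longlongrightarrow> 2 * A / (1 + 1)) (at_left 1)"
    by (intro tendsto_intros) auto
  moreover have "\<forall>\<^sub>F r in at_left (1::real).
      cmod ((f (of_real r * \<sigma>) - \<sigma>) / (of_real r * \<sigma> - \<sigma>)) \<le> 2 * A / (1 + r)"
  proof -
    have "\<forall>\<^sub>F r in at_left (1::real). 0 < r \<and> r < 1"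
      using eventually_at_left_real[of 0 1] by (auto elim: eventually_mono)
    then show ?thesis
    proof (eventually_elim)
      case (elim r)
      define u where "u = f (of_real r * \<sigma>)"
      define q where "q = cmod (\<sigma> - u)"
      have r\<sigma>: "cmod (of_real r * \<sigma>) = r"
        using elim \<sigma> by (simp add: norm_mult)
      have "\<sigma> - of_real r * \<sigma> = of_real (1 - r) * \<sigma>"
        by (simp add: algebra_simps)
      then have dr: "cmod (\<sigma> - of_real r * \<sigma>) = 1 - r"
        using elim \<sigma> by (simp add: norm_mult del: of_real_diff)
      have u: "cmod u < 1"
        unfolding u_def by (rule f1) (use r\<sigma> elim in simp)
      have q1: "1 - cmod u \<le> q"
        using norm_triangle_ineq2[of \<sigma> u] \<sigma> by (simp add: q_def)
      then have q0: "0 < q" using u by simp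
      have "1 - (cmod u)\<^sup>2 = (1 - cmod u) * (1 + cmod u)"
        by (simp add: power2_eq_square algebra_simps)
      also have "\<dots> \<le> q * 2"
        using q1 u q0 by (intro mult_mono) auto
      finally have q2: "1 - (cmod u)\<^sup>2 \<le> 2 * q"
        by simp
      have "q\<^sup>2 * (1 - r\<^sup>2) \<le> A * (1 - r)\<^sup>2 * (1 - (cmod u)\<^sup>2)"
        using julia[of "of_real r * \<sigma>"] r\<sigma> elim by (simp add: dr q_def u_def)
      also have "\<dots> \<le> A * (1 - r)\<^sup>2 * (2 * q)"
        using q2 A by (intro mult_left_mono) auto
      finally have "(q * (1 - r)) * (q * (1 + r)) \<le> (q * (1 - r)) * (2 * A * (1 - r))"
        by (simp add: power2_eq_square algebra_simps)
      then have "q * (1 + r) \<le> 2 * A * (1 - r)"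
        using q0 elim by (simp only: mult_le_cancel_left_pos mult_pos_pos diff_gt_0_iff_gt)
      then have "q / (1 - r) \<le> 2 * A / (1 + r)"
        using elim by (simp add: field_simps)
      then show ?case
        using dr by (simp add: norm_divide norm_minus_commute q_def u_def)
    qed
  qed
  ultimately have "cmod d \<le> 2 * A / (1 + 1)"
    by (intro tendsto_le[of "at_left (1::real)"]) auto
  then show False
    using A by simp
qed

section \<open>Growth of real sequences and functions\<close>

text \<open>
  The Cesaro mean of a convergent sequence, applied to the increments of \<open>x\<close>.
\<close>
lemma LIMSEQ_div_of_LIMSEQ_diff:
  fixes x :: "nat \<Rightarrow> real"
  assumes "(\<lambda>n. x (Suc n) - x n) \<longlonglongrightarrow> L"
  shows "(\<lambda>n. x n / real n) \<longlonglongrightarrow> L"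
proof (rule LIMSEQ_I)
  fix \<epsilon> :: real
  assume \<epsilon>: "0 < \<epsilon>"
  obtain N where N: "\<And>n. n \<ge> N \<Longrightarrow> \<bar>x (Suc n) - x n - L\<bar> < \<epsilon> / 2"
    using LIMSEQ_D[OF assms, of "\<epsilon> / 2"] \<epsilon> by auto
  define c where "c = \<bar>x N - real N * L\<bar>"
  have bound: "\<bar>x (N + k) - real (N + k) * L\<bar> \<le> c + real k * (\<epsilon> / 2)" for k
  proof (induction k)
    case (Suc k)
    have "real (N + Suc k) * L = real (N + k) * L + L" "real (Suc k) * (\<epsilon> / 2) = real k * (\<epsilon> / 2) + \<epsilon> / 2"
      by (simp_all add: algebra_simps)
    then show ?case
      using Suc.IH N[of "N + k"] unfolding add_Suc_right by linarith
  qed (simp add: c_def)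
  obtain m :: nat where m: "2 * c / \<epsilon> < real m"
    using reals_Archimedean2 by blast
  have "\<bar>x n / real n - L\<bar> < \<epsilon>" if n: "n \<ge> N + m + 1" for n
  proof -
    have "\<bar>x n - real n * L\<bar> \<le> c + real (n - N) * (\<epsilon> / 2)"
      using bound[of "n - N"] n by simp
    also have "\<dots> \<le> c + real n * (\<epsilon> / 2)"
      using \<epsilon> by simp
    also have "\<dots> < real n * \<epsilon>"
    proof -
      have "2 * c < real m * \<epsilon>"
        using m \<epsilon> by (simp add: field_simps)
      also have "\<dots> \<le> real n * \<epsilon>"
        using n \<epsilon> by (intro mult_right_mono) auto
      finally show ?thesis by simp
    qed
    finally have "\<bar>x n - real n * L\<bar> / real n < \<epsilon>"
      using n by (simp add: field_simps)
    moreover have "x n / real n - L = (x n - real n * L) / real n"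
      using n by (simp add: field_simps)
    ultimately show ?thesis
      by simp
  qed
  then show "\<exists>no. \<forall>n\<ge>no. norm (x n / real n - L) < \<epsilon>"
    by auto
qed

text \<open>
  This transfers the growth rate from the times \<open>n\<delta>\<close> to real times: \<open>F\<close> is sampled with a bounded error,
  which is negligible after division by \<open>u\<close>.
\<close>
lemma tendsto_rate_of_discrete_rate:
  fixes a :: "nat \<Rightarrow> real" and F :: "real \<Rightarrow> real"
  assumes \<delta>: "0 < \<delta>" and a: "(\<lambda>n. a n / real n) \<longlonglongrightarrow> L"
    and close: "\<And>u. 0 \<le> u \<Longrightarrow> \<bar>F u - a (nat \<lfloor>u / \<delta>\<rfloor>)\<bar> \<le> c"
  shows "((\<lambda>u. F u / u) \<longlongrightarrow> L / \<delta>) at_top"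
proof -
  define n where "n u = nat \<lfloor>u / \<delta>\<rfloor>" for u
  have n: "\<bar>real (n u) - u / \<delta>\<bar> \<le> 1" if "0 \<le> u" for u
    using that \<delta> by (simp add: n_def) linarith
  have top: "filterlim n sequentially at_top"
    unfolding filterlim_at_top
  proof
    fix m
    show "\<forall>\<^sub>F u in at_top. m \<le> n u"
      using eventually_ge_at_top[of "(real m + 1) * \<delta>"] eventually_ge_at_top[of 0]
    proof eventually_elim
      case (elim u)
      have "real m + 1 \<le> u / \<delta>"
        using elim \<delta> by (simp add: field_simps)
      then show ?case
        using n[OF elim(2)] by linarith
    qed
  qed
  have "((\<lambda>u. real (n u) / u - 1 / \<delta>) \<longlongrightarrow> 0) at_top"
  proof (rule Lim_null_comparison)
    show "\<forall>\<^sub>F u in at_top. norm (real (n u) / u - 1 / \<delta>) \<le> 1 / u"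
      using eventually_gt_at_top[of 0]
    proof eventually_elim
      case (elim u)
      have "real (n u) / u - 1 / \<delta> = (real (n u) - u / \<delta>) / u"
        using elim by (simp add: field_simps)
      then show ?case
        using n[of u] elim by (simp add: divide_right_mono)
    qed
    show "((\<lambda>u::real. 1 / u) \<longlongrightarrow> 0) at_top"
      by (intro tendsto_divide_0[OF tendsto_const] filterlim_at_top_imp_at_infinity filterlim_ident)
  qed
  then have ratio: "((\<lambda>u. real (n u) / u) \<longlongrightarrow> 1 / \<delta>) at_top"
    by (rule Lim_null[THEN iffD2])
  have "((\<lambda>u. (F u - a (n u)) / u) \<longlongrightarrow> 0) at_top"
  proof (rule Lim_null_comparison)
    show "\<forall>\<^sub>F u in at_top. norm ((F u - a (n u)) / u) \<le> c / u"
      using eventually_gt_at_top[of 0]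
      by eventually_elim (use close in \<open>simp add: n_def divide_right_mono\<close>)
    show "((\<lambda>u::real. c / u) \<longlongrightarrow> 0) at_top"
      by (intro tendsto_divide_0[OF tendsto_const] filterlim_at_top_imp_at_infinity filterlim_ident)
  qed
  moreover have "((\<lambda>u. a (n u) / real (n u) * (real (n u) / u)) \<longlongrightarrow> L * (1 / \<delta>)) at_top"
    by (intro tendsto_mult ratio filterlim_compose[OF a top])
  ultimately have "((\<lambda>u. (F u - a (n u)) / u + a (n u) / real (n u) * (real (n u) / u)) \<longlongrightarrow> 0 + L * (1 / \<delta>)) at_top"
    by (rule tendsto_add)
  moreover have "\<forall>\<^sub>F u in at_top. (F u - a (n u)) / u + a (n u) / real (n u) * (real (n u) / u) = F u / u"
    using filterlim_at_top[THEN iffD1, OF top, rule_format, of 1] eventually_gt_at_top[of "0::real"]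
    by eventually_elim (simp add: field_simps)
  ultimately show ?thesis
    by (auto elim: Lim_transform_eventually)
qed

section \<open>Backward iteration of a self-map of the disc\<close>

text \<open>
  A hyperbolic ball around \<open>z\<close> of bounded radius has Euclidean size comparable to the distance of
  \<open>z\<close> from the unit circle.
\<close>
lemma norm_diff_le_of_hyp_dist_le:
  assumes z: "cmod z < 1" and w: "cmod w < 1" and H: "hyp_dist z w \<le> H"
  shows "cmod (z - w) \<le> (exp (2 * H) - 1) / 2 * (1 - (cmod z)\<^sup>2)"
proof -
  define p where "p = pseudohyp_dist z w"
  have p: "0 \<le> p" "p < 1"
    using pseudohyp_dist_less_1[OF z w] by (auto simp: p_def)
  have "ln ((1 + p) / (1 - p)) \<le> 2 * H"
    using H by (simp add: hyp_dist_eq artanh_def p_def)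
  then have "(1 + p) / (1 - p) \<le> exp (2 * H)"
    using p by (metis (no_types) exp_le_cancel_iff exp_ln add_pos_nonneg diff_gt_0_iff_gt divide_pos_pos zero_less_one)
  then have pH: "p / (1 - p) \<le> (exp (2 * H) - 1) / 2"
    using p by (simp add: field_simps)
  have "1 - cnj z * w = of_real (1 - (cmod z)\<^sup>2) + cnj z * (z - w)"
    using complex_norm_square[of z] by (simp add: algebra_simps)
  then have "cmod (1 - cnj z * w) \<le> (1 - (cmod z)\<^sup>2) + cmod z * cmod (z - w)"
    using norm_triangle_ineq[of "of_real (1 - (cmod z)\<^sup>2)" "cnj z * (z - w)"] one_minus_norm_square_pos[OF z]
    by (simp add: norm_mult del: of_real_diff)
  also have "\<dots> \<le> (1 - (cmod z)\<^sup>2) + cmod (z - w)"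
    using z by (simp add: mult_left_le_one_le)
  finally have "p * cmod (1 - cnj z * w) \<le> p * ((1 - (cmod z)\<^sup>2) + cmod (z - w))"
    using p by (intro mult_left_mono) auto
  moreover have "cmod (z - w) = p * cmod (1 - cnj z * w)"
    using one_minus_cnj_mult_nonzero[OF z w] by (simp add: p_def pseudohyp_dist_def norm_divide)
  ultimately have "(1 - p) * cmod (z - w) \<le> p * (1 - (cmod z)\<^sup>2)"
    by (simp add: algebra_simps)
  then have "cmod (z - w) \<le> p / (1 - p) * (1 - (cmod z)\<^sup>2)"
    using p by (simp add: field_simps)
  also have "\<dots> \<le> (exp (2 * H) - 1) / 2 * (1 - (cmod z)\<^sup>2)"
    using pH one_minus_norm_square_pos[OF z] by (intro mult_right_mono) auto
  finally show ?thesis .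
qed

text \<open>
  With \<open>e\<^sub>n = 1 - |w\<^sub>n|\<^sup>2\<close>, the step from \<open>w\<^sub>n\<close> has length at most a multiple of \<open>e\<^sub>n\<close>, and geometric
  decay bounds \<open>e\<^sub>n\<close> by a multiple of \<open>e\<^sub>n - e\<^bsub>n+1\<^esub>\<close>. The bound on the steps thus telescopes, and
  the whole tail of the sequence beyond \<open>w\<^sub>n\<close> has length at most a multiple of \<open>e\<^sub>n\<close>.
\<close>
theorem stolz_approach_of_geometric_decay:
  fixes w :: "nat \<Rightarrow> complex"
  assumes w: "\<And>n. cmod (w n) < 1" and lim: "w \<longlonglongrightarrow> \<sigma>"
    and step: "\<And>n. hyp_dist (w n) (w (Suc n)) \<le> H"
    and A: "1 < A"
    and decay: "\<forall>\<^sub>F n in sequentially. A * (1 - (cmod (w (Suc n)))\<^sup>2) \<le> 1 - (cmod (w n))\<^sup>2"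
  obtains M where "1 < M" "\<forall>\<^sub>F n in sequentially. w n \<in> stolz_region \<sigma> M"
proof -
  define e where "e n = 1 - (cmod (w n))\<^sup>2" for n
  have e: "0 < e n" for n
    using one_minus_norm_square_pos[OF w] by (simp add: e_def)
  define B where "B = (exp (2 * H) - 1) / 2"
  define K where "K = B * A / (A - 1)"
  have "0 \<le> H"
    using step[of 0] hyp_dist_nonneg[OF w w, of 0 "Suc 0"] by linarith
  then have B: "0 \<le> B" and K: "0 \<le> K"
    using A by (auto simp: B_def K_def)
  obtain N where N: "\<And>n. n \<ge> N \<Longrightarrow> A * e (Suc n) \<le> e n"
    using decay by (auto simp: eventually_sequentially e_def)
  have one: "cmod (w n - w (Suc n)) \<le> K * (e n - e (Suc n))" if "n \<ge> N" for n
  proof -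
    have "B * e n * (A - 1) \<le> B * (A * (e n - e (Suc n)))"
      using N[OF that] B mult_left_mono[of "e n * (A - 1)" "A * (e n - e (Suc n))" B]
      by (simp add: algebra_simps)
    then have "B * e n \<le> K * (e n - e (Suc n))"
      using A by (simp add: K_def field_simps)
    moreover have "cmod (w n - w (Suc n)) \<le> B * e n"
      using norm_diff_le_of_hyp_dist_le[OF w w step] by (simp add: B_def e_def)
    ultimately show ?thesis by simp
  qed
  have many: "cmod (w n - w (n + k)) \<le> K * (e n - e (n + k))" if "n \<ge> N" for n k
  proof (induction k)
    case (Suc k)
    have "cmod (w n - w (n + Suc k)) \<le> cmod (w n - w (n + k)) + cmod (w (n + k) - w (Suc (n + k)))"
      using norm_triangle_ineq[of "w n - w (n + k)" "w (n + k) - w (Suc (n + k))"] by simp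
    also have "\<dots> \<le> K * (e n - e (n + k)) + K * (e (n + k) - e (Suc (n + k)))"
      using Suc.IH one[of "n + k"] that by (intro add_mono) auto
    also have "\<dots> = K * (e n - e (n + Suc k))"
      by (simp add: algebra_simps)
    finally show ?case .
  qed simp
  \<comment> \<open>Let \<open>k \<rightarrow> \<infinity>\<close>.\<close>
  have close: "cmod (w n - \<sigma>) \<le> K * e n" if "n \<ge> N" for n
  proof (rule tendsto_upperbound)
    show "(\<lambda>k. cmod (w n - w (n + k))) \<longlonglongrightarrow> cmod (w n - \<sigma>)"
      using LIMSEQ_ignore_initial_segment[OF lim, of n]
      by (intro tendsto_intros) (simp add: add.commute)
    have "cmod (w n - w (n + k)) \<le> K * e n" for k
    proof -
      have "cmod (w n - w (n + k)) \<le> K * (e n - e (n + k))"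
        by (rule many[OF that])
      also have "\<dots> \<le> K * e n"
        using K e[of "n + k"] by (intro mult_left_mono) auto
      finally show ?thesis .
    qed
    then show "\<forall>\<^sub>F k in sequentially. cmod (w n - w (n + k)) \<le> K * e n"
      by simp
  qed simp
  have "w n \<in> stolz_region \<sigma> (2 * K + 2)" if "n \<ge> N" for n
  proof -
    have "e n = (1 - cmod (w n)) * (1 + cmod (w n))"
      by (simp add: e_def power2_eq_square algebra_simps)
    also have "\<dots> \<le> (1 - cmod (w n)) * 2"
      using w[of n] by (intro mult_left_mono) auto
    finally have "K * e n \<le> K * ((1 - cmod (w n)) * 2)"
      using K by (rule mult_left_mono)
    then have "cmod (w n - \<sigma>) \<le> 2 * K * (1 - cmod (w n))"
      using close[OF that] by (simp add: algebra_simps)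
    also have "\<dots> < (2 * K + 2) * (1 - cmod (w n))"
      using w[of n] by (intro mult_strict_right_mono) auto
    finally show ?thesis
      using w[of n] by (simp add: stolz_region_def norm_minus_commute)
  qed
  then have "\<forall>\<^sub>F n in sequentially. w n \<in> stolz_region \<sigma> (2 * K + 2)"
    by (auto simp: eventually_sequentially)
  with K show thesis
    by (intro that[of "2 * K + 2"]) auto
qed

text \<open>
  In a Stolz region \<open>|z - \<sigma>|\<close> and \<open>1 - |z|\<close> differ at most by a factor \<open>M\<close>, and
  \<open>2 artanh |z| = ln (1 + |z|) - ln (1 - |z|)\<close>.
\<close>
lemma artanh_norm_stolz_bounds:
  assumes \<sigma>: "cmod \<sigma> = 1" and z: "z \<in> stolz_region \<sigma> M" and M: "1 < M"
  shows "\<bar>2 * artanh (cmod z) + ln (cmod (z - \<sigma>))\<bar> \<le> ln 2 + ln M"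
proof -
  define r where "r = cmod z"
  have r: "0 \<le> r" "r < 1" and up: "cmod (z - \<sigma>) < M * (1 - r)"
    using z by (auto simp: stolz_region_def r_def norm_minus_commute)
  have lo: "1 - r \<le> cmod (z - \<sigma>)"
    using norm_triangle_ineq2[of \<sigma> z] \<sigma> by (simp add: r_def norm_minus_commute)
  have "2 * artanh r = ln (1 + r) - ln (1 - r)"
    using r by (simp add: artanh_def ln_div)
  moreover have "0 \<le> ln (1 + r)" "ln (1 + r) \<le> ln 2"
    using r by auto
  moreover have "ln (1 - r) \<le> ln (cmod (z - \<sigma>))"
    using lo r by (intro ln_mono) auto
  moreover have "ln (cmod (z - \<sigma>)) \<le> ln (M * (1 - r))"
    using up lo r by (intro ln_mono) auto
  moreover have "ln (M * (1 - r)) = ln M + ln (1 - r)"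
    using M r by (simp add: ln_mult)
  moreover have "0 \<le> ln M"
    using M by simp
  ultimately show ?thesis
    unfolding r_def[symmetric] by linarith
qed

text \<open>
  The increments of \<open>-ln |w\<^sub>n - \<sigma>|\<close> tend to \<open>ln \<alpha>\<close>, and this sequence is twice the hyperbolic
  distance up to a bounded error.
\<close>
theorem hyp_dist_rate_of_stolz_approach:
  fixes w :: "nat \<Rightarrow> complex"
  assumes \<sigma>: "cmod \<sigma> = 1" and M: "1 < M"
    and stolz: "\<forall>\<^sub>F n in sequentially. w n \<in> stolz_region \<sigma> M"
    and \<alpha>: "0 < \<alpha>"
    and quot: "(\<lambda>n. (w n - \<sigma>) / (w (Suc n) - \<sigma>)) \<longlonglongrightarrow> of_real \<alpha>"
  shows "(\<lambda>n. hyp_dist 0 (w n) / real n) \<longlonglongrightarrow> ln \<alpha> / 2"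
proof -
  define x where "x n = - ln (cmod (w n - \<sigma>))" for n
  have neq: "\<forall>\<^sub>F n in sequentially. w n \<noteq> \<sigma>"
    using stolz by eventually_elim (use \<sigma> in \<open>auto simp: stolz_region_def\<close>)
  have "(\<lambda>n. ln (cmod ((w n - \<sigma>) / (w (Suc n) - \<sigma>)))) \<longlonglongrightarrow> ln (cmod (of_real \<alpha>))"
    using quot \<alpha> by (intro tendsto_intros) auto
  moreover have "\<forall>\<^sub>F n in sequentially. ln (cmod ((w n - \<sigma>) / (w (Suc n) - \<sigma>))) = x (Suc n) - x n"
    using neq eventually_sequentially_Suc[THEN iffD2, OF neq]
    by eventually_elim (simp add: x_def norm_divide ln_div)
  ultimately have "(\<lambda>n. x (Suc n) - x n) \<longlonglongrightarrow> ln \<alpha>"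
    using \<alpha> by (auto elim: Lim_transform_eventually)
  then have x: "(\<lambda>n. x n / real n) \<longlonglongrightarrow> ln \<alpha>"
    by (rule LIMSEQ_div_of_LIMSEQ_diff)
  have "(\<lambda>n. (2 * hyp_dist 0 (w n) - x n) / real n) \<longlonglongrightarrow> 0"
  proof (rule Lim_null_comparison)
    show "\<forall>\<^sub>F n in sequentially. norm ((2 * hyp_dist 0 (w n) - x n) / real n) \<le> (ln 2 + ln M) / real n"
      using stolz
    proof eventually_elim
      case (elim n)
      show ?case
        using artanh_norm_stolz_bounds[OF \<sigma> elim M]
        by (simp add: x_def hyp_dist_zero_left divide_right_mono)
    qed
    show "(\<lambda>n. (ln 2 + ln M) / real n) \<longlonglongrightarrow> 0"
      by (rule lim_const_over_n)
  qed
  from tendsto_add[OF this x] have "(\<lambda>n. 2 * hyp_dist 0 (w n) / real n) \<longlonglongrightarrow> ln \<alpha>"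
    by (simp add: add_divide_distrib[symmetric])
  then have "(\<lambda>n. 2 * hyp_dist 0 (w n) / real n / 2) \<longlonglongrightarrow> ln \<alpha> / 2"
    by (intro tendsto_divide) auto
  then show ?thesis
    by simp
qed

text \<open>
  Any \<open>A\<close> strictly between \<open>1\<close> and \<open>\<alpha>\<close> gives geometric decay of \<open>1 - |w\<^sub>n|\<^sup>2\<close>, hence approach
  in a Stolz region. Only then may the angular derivative be evaluated along the sequence itself.
\<close>
theorem backward_iteration_rate:
  fixes w :: "nat \<Rightarrow> complex"
  assumes hol: "f holomorphic_on unit_disc" and im: "f ` unit_disc \<subseteq> unit_disc"
    and \<sigma>: "cmod \<sigma> = 1"
    and deriv: "has_angular_deriv_fixed f \<sigma> (of_real \<alpha>)" and \<alpha>: "1 < \<alpha>"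
    and w: "\<And>n. cmod (w n) < 1" and backward: "\<And>n. f (w (Suc n)) = w n"
    and lim: "w \<longlonglongrightarrow> \<sigma>" and step: "\<And>n. hyp_dist (w n) (w (Suc n)) \<le> H"
  shows "(\<lambda>n. hyp_dist 0 (w n) / real n) \<longlonglongrightarrow> ln \<alpha> / 2"
proof -
  have lim_Suc: "(\<lambda>n. w (Suc n)) \<longlonglongrightarrow> \<sigma>"
    using lim by (rule LIMSEQ_Suc)
  define A where "A = (1 + \<alpha>) / 2"
  have A: "1 < A" "A < \<alpha>"
    using \<alpha> by (auto simp: A_def)
  have "\<forall>\<^sub>F n in sequentially. A * (1 - (cmod (w (Suc n)))\<^sup>2) < 1 - (cmod (f (w (Suc n))))\<^sup>2"
    using A w lim lim_Suc by (intro julia_eventually_ratio[OF hol im \<sigma> deriv]) (auto simp: backward)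
  then have "\<forall>\<^sub>F n in sequentially. A * (1 - (cmod (w (Suc n)))\<^sup>2) \<le> 1 - (cmod (w n))\<^sup>2"
    by eventually_elim (simp add: backward)
  then obtain M where M: "1 < M" and stolz: "\<forall>\<^sub>F n in sequentially. w n \<in> stolz_region \<sigma> M"
    using stolz_approach_of_geometric_decay[OF w lim step A(1)] by blast
  have quot: "((\<lambda>x. (f x - \<sigma>) / (x - \<sigma>)) \<longlongrightarrow> of_real \<alpha>) (at \<sigma> within stolz_region \<sigma> M)"
    using deriv M by (simp add: has_angular_deriv_fixed_def has_angular_limit_def)
  have "w n \<noteq> \<sigma>" for n
    using w[of n] \<sigma> by auto
  then have "filterlim (\<lambda>n. w (Suc n)) (at \<sigma> within stolz_region \<sigma> M) sequentially"
    using lim_Suc eventually_sequentially_Suc[THEN iffD2, OF stolz] by (simp add: filterlim_at)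
  from filterlim_compose[OF quot this]
  have "(\<lambda>n. (w n - \<sigma>) / (w (Suc n) - \<sigma>)) \<longlonglongrightarrow> of_real \<alpha>"
    by (simp add: backward)
  then show ?thesis
    using \<alpha> by (intro hyp_dist_rate_of_stolz_approach[OF \<sigma> M stolz]) auto
qed

section \<open>Univalence of the semigroup\<close>

text \<open>
  By Cauchy's estimate the derivative of \<open>g - id\<close> is at most \<open>1/2\<close> on the smaller ball, so \<open>g\<close>
  differs from the identity there by a map with Lipschitz constant \<open>1/2\<close>.
\<close>
lemma inj_on_near_identity:
  assumes hol: "g holomorphic_on ball c r" and near: "\<And>x. x \<in> ball c r \<Longrightarrow> cmod (g x - x) \<le> r / 8"
  shows "inj_on g (ball c (r / 2))"
proof (rule inj_onI)
  define h where "h x = g x - x" for x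
  have hh: "h holomorphic_on ball c r"
    unfolding h_def by (intro holomorphic_intros hol)
  fix x y assume x: "x \<in> ball c (r / 2)" and y: "y \<in> ball c (r / 2)" and eq: "g x = g y"
  have r: "0 < r"
    using x by (metis half_gt_zero_iff mem_ball zero_le_dist le_less_trans)
  have "cmod (deriv h u) \<le> 1 / 2" if u: "u \<in> ball c (r / 2)" for u
  proof -
    have cb: "cball u (r / 4) \<subseteq> ball c r"
      using u r by (intro cball_subset_ball_iff[THEN iffD2]) (auto simp: dist_commute)
    have "cmod ((deriv ^^ 1) h u) \<le> fact 1 * (r / 8) / (r / 4) ^ 1"
    proof (rule Cauchy_inequality)
      show "h holomorphic_on ball u (r / 4)"
        using hh cb by (meson ball_subset_cball holomorphic_on_subset subset_trans)
      show "continuous_on (cball u (r / 4)) h"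
        using hh cb holomorphic_on_imp_continuous_on holomorphic_on_subset by blast
      show "cmod (h v) \<le> r / 8" if "cmod (u - v) = r / 4" for v
        using near[of v] cb that by (auto simp: h_def dist_norm)
    qed (use r in simp)
    then show ?thesis
      using r by simp
  qed
  moreover have "(h has_field_derivative deriv h u) (at u within ball c (r / 2))" if "u \<in> ball c (r / 2)" for u
    using that r by (intro has_field_derivative_at_within[OF holomorphic_derivI[OF hh open_ball]]) auto
  ultimately have "cmod (h y - h x) \<le> 1 / 2 * cmod (y - x)"
    using field_differentiable_bound[OF convex_ball, of c "r / 2" h "deriv h" "1 / 2" y x] x y by blast
  then show "x = y"
    using eq by (simp add: h_def norm_minus_commute)
qed

context
  fixes \<phi> :: "real \<Rightarrow> complex \<Rightarrow> complex"
  assumes sg: "disc_semigroup \<phi>"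
begin

lemma
  shows semigroup_holomorphic: "0 \<le> t \<Longrightarrow> \<phi> t holomorphic_on unit_disc"
    and semigroup_image: "0 \<le> t \<Longrightarrow> \<phi> t ` unit_disc \<subseteq> unit_disc"
    and semigroup_norm: "0 \<le> t \<Longrightarrow> cmod z < 1 \<Longrightarrow> cmod (\<phi> t z) < 1"
    and semigroup_0: "cmod z < 1 \<Longrightarrow> \<phi> 0 z = z"
    and semigroup_add: "0 \<le> t \<Longrightarrow> 0 \<le> s \<Longrightarrow> cmod z < 1 \<Longrightarrow> \<phi> (t + s) z = \<phi> t (\<phi> s z)"
    and semigroup_uniform: "compact K \<Longrightarrow> K \<subseteq> unit_disc \<Longrightarrow> uniform_limit K \<phi> (\<lambda>z. z) (at_right 0)"
  using sg by (auto simp: disc_semigroup_def image_subset_iff)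

lemma semigroup_tendsto_0:
  assumes "cmod z < 1"
  shows "((\<lambda>t. \<phi> t z) \<longlongrightarrow> z) (at_right 0)"
  using tendsto_uniform_limitI[OF semigroup_uniform[of "{z}"], of z] assms by auto

lemma semigroup_pseudohyp_dist_le:
  assumes "0 \<le> s" "s \<le> t" "cmod z < 1"
  shows "pseudohyp_dist (\<phi> s z) (\<phi> t z) \<le> pseudohyp_dist z (\<phi> (t - s) z)"
  using schwarz_pick[OF semigroup_holomorphic semigroup_image, of s z "\<phi> (t - s) z"]
    semigroup_add[of s "t - s" z] semigroup_norm[of "t - s" z] assms by simp

text \<open>
  Continuity at \<open>0\<close> from the right extends to both sides of every time, because \<open>\<phi>\<^sub>s\<close> contracts:
  \<open>\<phi>\<^sub>s(z)\<close> and \<open>\<phi>\<^sub>t(z) = \<phi>\<^sub>s(\<phi>\<^bsub>t-s\<^esub>(z))\<close> are no further apart than \<open>z\<close> and \<open>\<phi>\<^bsub>t-s\<^esub>(z)\<close>.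
\<close>
lemma semigroup_continuous_in_time:
  assumes z: "cmod z < 1"
  shows "continuous_on {0..} (\<lambda>t. \<phi> t z)"
proof -
  have "((\<lambda>t. pseudohyp_dist z (\<phi> t z)) \<longlongrightarrow> cmod ((z - z) / (1 - cnj z * z))) (at_right 0)"
    unfolding pseudohyp_dist_def
    using one_minus_cnj_mult_nonzero[OF z z] by (intro tendsto_intros semigroup_tendsto_0 z) auto
  then have lim: "((\<lambda>t. pseudohyp_dist z (\<phi> t z)) \<longlongrightarrow> 0) (at_right 0)"
    by simp
  show ?thesis
    unfolding continuous_on_iff
  proof (intro ballI allI impI)
    fix s e :: real
    assume s: "s \<in> {0..}" and e: "0 < e"
    have "\<forall>\<^sub>F t in at_right 0. pseudohyp_dist z (\<phi> t z) < e / 2"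
      using order_tendstoD(2)[OF lim, of "e / 2"] e by linarith
    then obtain d where d: "0 < d" "\<And>t. 0 < t \<Longrightarrow> t < d \<Longrightarrow> pseudohyp_dist z (\<phi> t z) < e / 2"
      by (auto simp: eventually_at_right_field)
    have close: "cmod (\<phi> u z - \<phi> v z) < e" if "0 \<le> u" "u \<le> v" "v - u < d" for u v
    proof (cases "u = v")
      case False
      have "cmod (\<phi> u z - \<phi> v z) \<le> 2 * pseudohyp_dist (\<phi> u z) (\<phi> v z)"
        using that z by (intro norm_diff_le_pseudohyp_dist semigroup_norm) auto
      also have "\<dots> \<le> 2 * pseudohyp_dist z (\<phi> (v - u) z)"
        using semigroup_pseudohyp_dist_le[of u v z] that z by simp
      also have "\<dots> < e"
        using d(2)[of "v - u"] that False by simp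
      finally show ?thesis .
    qed (use e in simp)
    have "dist (\<phi> t z) (\<phi> s z) < e" if "t \<in> {0..}" "dist t s < d" for t
    proof (cases "s \<le> t")
      case True
      then show ?thesis
        using close[of s t] that s by (simp add: dist_norm norm_minus_commute)
    next
      case False
      then show ?thesis
        using close[of t s] that s by (simp add: dist_norm)
    qed
    then show "\<exists>d>0. \<forall>t\<in>{0..}. dist t s < d \<longrightarrow> dist (\<phi> t z) (\<phi> s z) < e"
      using d(1) by auto
  qed
qed

text \<open>
  Suppose the trajectories of two distinct points meet, and let \<open>t\<^sub>0 > 0\<close> be the first meeting time. Just
  before \<open>t\<^sub>0\<close> the two trajectories are at distinct points near the meeting point \<open>c\<close>, and a short
  flow, which is univalent near \<open>c\<close> because it is close to the identity, merges them: a
  contradiction.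
\<close>
theorem semigroup_inj_on:
  assumes t: "0 \<le> t"
  shows "inj_on (\<phi> t) unit_disc"
proof (rule inj_onI, rule ccontr)
  fix a b assume ab: "a \<in> unit_disc" "b \<in> unit_disc" "\<phi> t a = \<phi> t b" "a \<noteq> b"
  define T where "T = {s \<in> {0..}. \<phi> s a - \<phi> s b = 0}"
  define t0 where "t0 = Inf T"
  have bdd: "bdd_below T"
    unfolding T_def by (intro bdd_belowI[of _ 0]) auto
  have cont: "continuous_on {0..} (\<lambda>s. \<phi> s a)" "continuous_on {0..} (\<lambda>s. \<phi> s b)"
    using ab by (auto intro: semigroup_continuous_in_time)
  have "closed T"
    unfolding T_def
    by (intro continuous_closed_preimage_constant continuous_on_diff cont) auto
  moreover have "T \<noteq> {}"
    using ab t by (auto simp: T_def)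
  ultimately have "t0 \<in> T"
    unfolding t0_def using bdd by (intro closed_contains_Inf)
  then have t0: "0 \<le> t0" "\<phi> t0 a = \<phi> t0 b"
    by (auto simp: T_def)
  have "t0 \<noteq> 0"
    using t0 ab semigroup_0 by force
  with t0 have t0pos: "0 < t0" by simp
  define c where "c = \<phi> t0 a"
  have c: "cmod c < 1"
    using semigroup_norm t0 ab by (simp add: c_def)
  define r where "r = (1 - cmod c) / 2"
  have r: "0 < r" "cball c r \<subseteq> unit_disc"
  proof -
    show "0 < r" using c by (simp add: r_def)
    show "cball c r \<subseteq> unit_disc"
    proof
      fix x assume "x \<in> cball c r"
      then have "cmod (x - c) \<le> r"
        by (simp add: dist_norm norm_minus_commute)
      then show "x \<in> unit_disc"
        using norm_triangle_ineq2[of x c] c by (simp add: r_def)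
    qed
  qed
  have "\<forall>\<^sub>F s in at_right 0. \<forall>x\<in>cball c r. dist (\<phi> s x) x < r / 8"
    using semigroup_uniform[of "cball c r"] r by (intro uniform_limitD) auto
  moreover have "\<forall>\<^sub>F s in at_right 0. \<phi> (t0 - s) x \<in> ball c (r / 2)"
    if x: "cmod x < 1" "\<phi> t0 x = c" for x
  proof -
    have "filterlim (\<lambda>s. t0 - s) (at t0 within {0..}) (at_right 0)"
    proof -
      have "((\<lambda>s. t0 - s) \<longlongrightarrow> t0 - 0) (at_right 0)"
        by (intro tendsto_intros)
      moreover have "\<forall>\<^sub>F s in at_right 0. t0 - s \<in> {0..} \<and> t0 - s \<noteq> t0"
        using eventually_at_right_real[OF t0pos] by eventually_elim auto
      ultimately show ?thesis
        by (auto simp: filterlim_at)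
    qed
    moreover have "((\<lambda>s. \<phi> s x) \<longlongrightarrow> c) (at t0 within {0..})"
      using semigroup_continuous_in_time[OF x(1)] x(2) t0 by (auto simp: continuous_on_def)
    ultimately have "((\<lambda>s. \<phi> (t0 - s) x) \<longlongrightarrow> c) (at_right 0)"
      by (rule filterlim_compose[rotated])
    from tendstoD[OF this, of "r / 2"] r show ?thesis
      by (simp add: dist_commute)
  qed
  note this[of a] this[of b]
  moreover have "\<forall>\<^sub>F s in at_right 0. 0 < s \<and> s < t0"
    using eventually_at_right_real[OF t0pos] by eventually_elim auto
  ultimately have "\<forall>\<^sub>F s in at_right 0. (\<forall>x\<in>cball c r. dist (\<phi> s x) x < r / 8) \<and>
      \<phi> (t0 - s) a \<in> ball c (r / 2) \<and> \<phi> (t0 - s) b \<in> ball c (r / 2) \<and> 0 < s \<and> s < t0"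
    using ab t0 by (auto simp: c_def eventually_conj_iff)
  then obtain s where s: "\<And>x. x \<in> cball c r \<Longrightarrow> dist (\<phi> s x) x < r / 8"
      "\<phi> (t0 - s) a \<in> ball c (r / 2)" "\<phi> (t0 - s) b \<in> ball c (r / 2)" "0 < s" "s < t0"
    using eventually_happens'[OF trivial_limit_at_right_real] by blast
  have "\<phi> s holomorphic_on ball c r"
    using semigroup_holomorphic[of s] s(4) r(2) ball_subset_cball
    by (meson holomorphic_on_subset less_imp_le subset_trans)
  moreover have "cmod (\<phi> s x - x) \<le> r / 8" if "x \<in> ball c r" for x
    using s(1)[of x] that by (simp add: dist_norm)
  ultimately have "inj_on (\<phi> s) (ball c (r / 2))"
    by (rule inj_on_near_identity)
  moreover have "\<phi> s (\<phi> (t0 - s) a) = \<phi> s (\<phi> (t0 - s) b)"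
    using semigroup_add[of s "t0 - s"] s ab t0 by simp
  ultimately have "\<phi> (t0 - s) a = \<phi> (t0 - s) b"
    using s by (auto dest: inj_onD)
  then have "t0 - s \<in> T"
    using s by (simp add: T_def)
  then have "t0 \<le> t0 - s"
    unfolding t0_def using bdd by (intro cInf_lower)
  then show False
    using s by simp
qed

section \<open>Petals are invariant under the flow\<close>

lemma backward_invariant_set_subset: "backward_invariant_set \<phi> \<subseteq> unit_disc"
  unfolding backward_invariant_set_def using semigroup_image[of 0] by auto

lemma backward_invariant_setE:
  assumes "x \<in> backward_invariant_set \<phi>" "0 \<le> s"
  obtains u where "cmod u < 1" "x = \<phi> s u"
  using assms unfolding backward_invariant_set_def by fastforce

lemma mem_backward_invariant_set_iff:
  assumes t: "0 \<le> t" and x: "cmod x < 1"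
  shows "\<phi> t x \<in> backward_invariant_set \<phi> \<longleftrightarrow> x \<in> backward_invariant_set \<phi>"
proof
  assume L: "\<phi> t x \<in> backward_invariant_set \<phi>"
  have "x \<in> \<phi> s ` unit_disc" if s: "0 \<le> s" for s
  proof -
    obtain u where u: "cmod u < 1" "\<phi> t x = \<phi> (t + s) u"
      using backward_invariant_setE[OF L, of "t + s"] t s by auto
    then have "\<phi> t x = \<phi> t (\<phi> s u)"
      using semigroup_add[OF t s] by simp
    then have "x = \<phi> s u"
      using semigroup_inj_on[OF t] x u semigroup_norm[OF s] by (auto dest!: inj_onD)
    then show ?thesis
      using u by auto
  qed
  then show "x \<in> backward_invariant_set \<phi>"
    by (auto simp: backward_invariant_set_def)
next
  assume R: "x \<in> backward_invariant_set \<phi>"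
  have "\<phi> t x \<in> \<phi> s ` unit_disc" if s: "0 \<le> s" for s
  proof (cases "s \<le> t")
    case True
    then have "\<phi> t x = \<phi> s (\<phi> (t - s) x)"
      using semigroup_add[OF s, of "t - s" x] x by simp
    then show ?thesis
      using semigroup_norm[of "t - s" x] True x by auto
  next
    case False
    then obtain u where u: "cmod u < 1" "x = \<phi> (s - t) u"
      using backward_invariant_setE[OF R, of "s - t"] by auto
    then have "\<phi> t x = \<phi> s u"
      using semigroup_add[OF t, of "s - t" u] False by simp
    then show ?thesis
      using u by auto
  qed
  then show "\<phi> t x \<in> backward_invariant_set \<phi>"
    by (auto simp: backward_invariant_set_def)
qed

text \<open>
  Being univalent, \<open>\<phi>\<^sub>t\<close> is an open map.
\<close>
lemma mem_interior_backward_invariant_set_iff: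
  assumes t: "0 \<le> t" and x: "cmod x < 1"
  shows "\<phi> t x \<in> interior (backward_invariant_set \<phi>) \<longleftrightarrow> x \<in> interior (backward_invariant_set \<phi>)"
    (is "_ \<in> interior ?W \<longleftrightarrow> _")
proof
  assume L: "\<phi> t x \<in> interior ?W"
  have "continuous_on unit_disc (\<phi> t)"
    using semigroup_holomorphic[OF t] by (rule holomorphic_on_imp_continuous_on)
  then have "open (unit_disc \<inter> \<phi> t -` interior ?W)"
    by (intro continuous_open_preimage) auto
  moreover have "unit_disc \<inter> \<phi> t -` interior ?W \<subseteq> ?W"
    using mem_backward_invariant_set_iff[OF t] interior_subset[of ?W] by auto
  ultimately show "x \<in> interior ?W"
    using L x by (meson IntI interior_maximal mem_ball_0 subsetD vimageI)
next
  assume R: "x \<in> interior ?W"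
  have sub: "interior ?W \<subseteq> unit_disc"
    using backward_invariant_set_subset interior_subset by blast
  have "open (\<phi> t ` interior ?W)"
    using semigroup_holomorphic[OF t] semigroup_inj_on[OF t] sub
    by (intro open_mapping_thm3) (auto intro: holomorphic_on_subset inj_on_subset)
  moreover have "\<phi> t ` interior ?W \<subseteq> ?W"
    using mem_backward_invariant_set_iff[OF t] interior_subset[of ?W] sub
    by (force simp: subset_iff)
  ultimately show "\<phi> t x \<in> interior ?W"
    using R by (meson imageI interior_maximal subsetD)
qed

context
  fixes \<Delta> :: "complex set"
  assumes pt: "petal \<phi> \<Delta>"
begin

lemma petal_subset_interior: "\<Delta> \<subseteq> interior (backward_invariant_set \<phi>)"
  using pt in_components_subset by (auto simp: petal_def)

lemma petal_subset: "\<Delta> \<subseteq> unit_disc"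
  using petal_subset_interior backward_invariant_set_subset interior_subset by blast

lemma petal_norm: "x \<in> \<Delta> \<Longrightarrow> cmod x < 1"
  using petal_subset by auto

lemma petal_open: "open \<Delta>"
  using pt open_components[OF open_interior] by (auto simp: petal_def)

lemma petal_connected: "connected \<Delta>"
  using pt in_components_connected by (auto simp: petal_def)

text \<open>
  The trajectory from \<open>x\<close> to \<open>\<phi>\<^sub>t(x)\<close> is a connected subset of the interior of the backward
  invariant set, so both endpoints lie in the same component.
\<close>
theorem mem_petal_iff:
  assumes t: "0 \<le> t" and x: "cmod x < 1"
  shows "\<phi> t x \<in> \<Delta> \<longleftrightarrow> x \<in> \<Delta>"
proof (cases "x \<in> interior (backward_invariant_set \<phi>)")
  case True
  let ?orbit = "(\<lambda>s. \<phi> s x) ` {0..t}"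
  have "connected ?orbit"
    using semigroup_continuous_in_time[OF x]
    by (intro connected_continuous_image) (auto intro: continuous_on_subset)
  moreover have "?orbit \<subseteq> interior (backward_invariant_set \<phi>)"
    using mem_interior_backward_invariant_set_iff x True by auto
  ultimately have "?orbit \<subseteq> \<Delta>" if "\<Delta> \<inter> ?orbit \<noteq> {}"
    using components_maximal[of \<Delta> "interior (backward_invariant_set \<phi>)" ?orbit] pt that
    by (auto simp: petal_def)
  moreover have "\<phi> t x \<in> ?orbit" "x \<in> ?orbit"
    using t semigroup_0[OF x] by (auto intro: image_eqI[of _ _ 0])
  ultimately show ?thesis
    by blast
next
  case False
  then show ?thesis
    using mem_interior_backward_invariant_set_iff[OF t x] petal_subset_interior by auto
qed

lemma petal_image:
  assumes t: "0 \<le> t"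
  shows "\<phi> t ` \<Delta> = \<Delta>"
proof
  show "\<phi> t ` \<Delta> \<subseteq> \<Delta>"
    using mem_petal_iff[OF t] petal_norm by auto
  show "\<Delta> \<subseteq> \<phi> t ` \<Delta>"
  proof
    fix y assume y: "y \<in> \<Delta>"
    then have "y \<in> backward_invariant_set \<phi>"
      using petal_subset_interior interior_subset by blast
    then obtain x where "cmod x < 1" "y = \<phi> t x"
      using t by (rule backward_invariant_setE)
    then show "y \<in> \<phi> t ` \<Delta>"
      using mem_petal_iff[OF t] y by auto
  qed
qed

lemma petal_inj_on: "0 \<le> t \<Longrightarrow> inj_on (\<phi> t) \<Delta>"
  using semigroup_inj_on petal_subset inj_on_subset by blast

lemma
  assumes s: "0 \<le> s" and z: "z \<in> \<Delta>"
  shows petal_flow_backward_mem: "petal_flow \<phi> \<Delta> (- s) z \<in> \<Delta>"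
    and semigroup_petal_flow_backward: "\<phi> s (petal_flow \<phi> \<Delta> (- s) z) = z"
proof -
  have "petal_flow \<phi> \<Delta> (- s) z \<in> \<Delta> \<and> \<phi> s (petal_flow \<phi> \<Delta> (- s) z) = z"
  proof (cases "s = 0")
    case True
    then show ?thesis
      using z semigroup_0 petal_norm by (simp add: petal_flow_def)
  next
    case False
    then show ?thesis
      using s z petal_image[OF s] inv_into_into[of z "\<phi> s" \<Delta>] f_inv_into_f[of z "\<phi> s" \<Delta>]
      by (simp add: petal_flow_def)
  qed
  then show "petal_flow \<phi> \<Delta> (- s) z \<in> \<Delta>" "\<phi> s (petal_flow \<phi> \<Delta> (- s) z) = z"
    by auto
qed

lemma petal_flow_backward_eqI:
  assumes "0 \<le> s" "y \<in> \<Delta>" "\<phi> s y = z"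
  shows "petal_flow \<phi> \<Delta> (- s) z = y"
proof -
  have z: "z \<in> \<Delta>"
    using mem_petal_iff[OF assms(1)] petal_norm assms by auto
  show ?thesis
    using petal_inj_on[OF assms(1)] petal_flow_backward_mem[OF assms(1) z]
      semigroup_petal_flow_backward[OF assms(1) z] assms by (auto dest: inj_onD)
qed

lemma semigroup_petal_flow_backward_add:
  assumes s: "0 \<le> s" and t: "0 \<le> t" and z: "z \<in> \<Delta>"
  shows "\<phi> s (petal_flow \<phi> \<Delta> (- (t + s)) z) = petal_flow \<phi> \<Delta> (- t) z"
proof -
  define y where "y = petal_flow \<phi> \<Delta> (- (t + s)) z"
  have y: "y \<in> \<Delta>" "\<phi> (t + s) y = z"
    using petal_flow_backward_mem[of "t + s" z] semigroup_petal_flow_backward[of "t + s" z] s t z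
    by (auto simp: y_def)
  then have "\<phi> t (\<phi> s y) = z"
    using semigroup_add[OF t s] petal_norm by simp
  moreover have "\<phi> s y \<in> \<Delta>"
    using y mem_petal_iff[OF s] petal_norm by simp
  ultimately have "petal_flow \<phi> \<Delta> (- t) z = \<phi> s y"
    by (intro petal_flow_backward_eqI t)
  then show ?thesis
    by (simp only: y_def)
qed

lemma petal_flow_backward_holomorphic:
  assumes s: "0 \<le> s"
  shows "petal_flow \<phi> \<Delta> (- s) holomorphic_on \<Delta>"
proof -
  have hol: "\<phi> s holomorphic_on \<Delta>"
    using semigroup_holomorphic[OF s] petal_subset by (rule holomorphic_on_subset)
  obtain g where g: "g holomorphic_on \<phi> s ` \<Delta>" "\<And>z. z \<in> \<Delta> \<Longrightarrow> g (\<phi> s z) = z"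
  proof (rule holomorphic_has_inverse[OF hol petal_open petal_inj_on[OF s]])
    fix g
    assume "g holomorphic_on \<phi> s ` \<Delta>" "\<And>z. z \<in> \<Delta> \<Longrightarrow> g (\<phi> s z) = z"
    then show thesis
      by (rule that)
  qed
  have "g z = petal_flow \<phi> \<Delta> (- s) z" if "z \<in> \<Delta>" for z
    using g(2)[OF petal_flow_backward_mem[OF s that]] semigroup_petal_flow_backward[OF s that] by simp
  then show ?thesis
    using g(1) petal_image[OF s] holomorphic_transform by metis
qed

text \<open>
  The relation "the backward trajectories stay at bounded hyperbolic distance" is an equivalence
  relation on the petal, and by the Schwarz-Pick lemma on discs it holds between neighbouring
  points. Connectedness of the petal makes it hold everywhere.
\<close>
theorem petal_flow_backward_hyp_dist_bounded:
  assumes p: "p \<in> \<Delta>" and q: "q \<in> \<Delta>"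
  obtains C where "\<And>s. 0 \<le> s \<Longrightarrow> hyp_dist (petal_flow \<phi> \<Delta> (- s) p) (petal_flow \<phi> \<Delta> (- s) q) \<le> C"
proof -
  define R where "R x y \<longleftrightarrow>
    (\<exists>C. \<forall>s\<ge>0. hyp_dist (petal_flow \<phi> \<Delta> (- s) x) (petal_flow \<phi> \<Delta> (- s) y) \<le> C)" for x y
  have pf: "cmod (petal_flow \<phi> \<Delta> (- s) x) < 1" if "0 \<le> s" "x \<in> \<Delta>" for s x
    using petal_norm petal_flow_backward_mem that by blast
  have "R p q"
  proof (rule connected_equivalence_relation[OF petal_connected p q])
    show "R y x" if "R x y" for x y
      using that by (simp add: R_def hyp_dist_commute)
    show "R x z" if xyz: "R x y" "R y z" "x \<in> \<Delta>" "y \<in> \<Delta>" "z \<in> \<Delta>" for x y z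
    proof -
      obtain C D where
        "\<And>s. 0 \<le> s \<Longrightarrow> hyp_dist (petal_flow \<phi> \<Delta> (- s) x) (petal_flow \<phi> \<Delta> (- s) y) \<le> C"
        "\<And>s. 0 \<le> s \<Longrightarrow> hyp_dist (petal_flow \<phi> \<Delta> (- s) y) (petal_flow \<phi> \<Delta> (- s) z) \<le> D"
        using xyz by (auto simp: R_def)
      then have "hyp_dist (petal_flow \<phi> \<Delta> (- s) x) (petal_flow \<phi> \<Delta> (- s) z) \<le> C + D" if "0 \<le> s" for s
        using hyp_dist_triangle[of "petal_flow \<phi> \<Delta> (- s) x" "petal_flow \<phi> \<Delta> (- s) y" "petal_flow \<phi> \<Delta> (- s) z"]
          pf that xyz(3-5) by (meson add_mono order_trans)
      then show ?thesis
        by (auto simp: R_def)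
    qed
    fix a assume a: "a \<in> \<Delta>"
    obtain r where r: "0 < r" "ball a r \<subseteq> \<Delta>"
      using petal_open a open_contains_ball by blast
    have "R a x" if x: "x \<in> ball a (r / 2)" for x
      unfolding R_def
    proof (intro exI allI impI)
      fix s :: real assume s: "0 \<le> s"
      have "hyp_dist (petal_flow \<phi> \<Delta> (- s) a) (petal_flow \<phi> \<Delta> (- s) x) \<le> artanh (cmod (x - a) / r)"
      proof (rule schwarz_pick_ball)
        show "petal_flow \<phi> \<Delta> (- s) holomorphic_on ball a r"
          using petal_flow_backward_holomorphic[OF s] r(2) by (rule holomorphic_on_subset)
        show "petal_flow \<phi> \<Delta> (- s) ` ball a r \<subseteq> unit_disc"
          using pf[OF s] r(2) by auto
      qed (use x r in auto)
      also have "\<dots> \<le> artanh (1 / 2)"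
        using x r by (intro artanh_mono_real) (auto simp: field_simps dist_norm norm_minus_commute)
      finally show "hyp_dist (petal_flow \<phi> \<Delta> (- s) a) (petal_flow \<phi> \<Delta> (- s) x) \<le> artanh (1 / 2)" .
    qed
    moreover have "ball a (r / 2) \<subseteq> \<Delta>"
      using r by (auto simp: subset_iff)
    ultimately show "\<exists>T. openin (top_of_set \<Delta>) T \<and> a \<in> T \<and> (\<forall>x\<in>T. R a x)"
      using r by (intro exI[of _ "ball a (r / 2)"]) (auto simp: openin_open_eq[OF petal_open])
  qed
  then show thesis
    using that by (auto simp: R_def)
qed

end

text \<open>
  For short times \<open>\<phi>\<^sub>s(0)\<close> stays near \<open>0\<close>, and \<open>\<phi>\<^sub>s\<close> contracts, so the distance to the origin
  can increase only by a bounded amount, uniformly in the starting point.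
\<close>
lemma semigroup_small_displacement:
  obtains \<delta> where "0 < \<delta>"
    "\<And>s x. 0 \<le> s \<Longrightarrow> s \<le> \<delta> \<Longrightarrow> cmod x < 1 \<Longrightarrow> hyp_dist 0 (\<phi> s x) \<le> hyp_dist 0 x + artanh (1 / 2)"
proof -
  have "\<forall>\<^sub>F s in at_right 0. cmod (\<phi> s 0) < 1 / 2"
    using tendstoD[OF semigroup_tendsto_0[of 0], of "1 / 2"] by simp
  then obtain d where d: "0 < d" "\<And>s. 0 < s \<Longrightarrow> s < d \<Longrightarrow> cmod (\<phi> s 0) < 1 / 2"
    by (auto simp: eventually_at_right_field)
  have "hyp_dist 0 (\<phi> s x) \<le> hyp_dist 0 x + artanh (1 / 2)"
    if s: "0 \<le> s" "s \<le> d / 2" and x: "cmod x < 1" for s x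
  proof -
    have "cmod (\<phi> s 0) \<le> 1 / 2"
      using d(2)[of s] d(1) s semigroup_0[of 0] by (cases "s = 0") auto
    then have "hyp_dist 0 (\<phi> s 0) \<le> artanh (1 / 2)"
      unfolding hyp_dist_zero_left by (intro artanh_mono_real) auto
    moreover have "hyp_dist (\<phi> s 0) (\<phi> s x) \<le> hyp_dist 0 x"
      using semigroup_holomorphic semigroup_image s x
      by (intro hyp_dist_contraction) auto
    moreover have "hyp_dist 0 (\<phi> s x) \<le> hyp_dist 0 (\<phi> s 0) + hyp_dist (\<phi> s 0) (\<phi> s x)"
      using semigroup_norm s x by (intro hyp_dist_triangle) auto
    ultimately show ?thesis
      by simp
  qed
  with d(1) show thesis
    by (intro that[of "d / 2"]) auto
qed

end

section \<open>The total speed of a petal\<close>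

theorem theorem4p1:
  fixes \<phi> :: "real \<Rightarrow> complex \<Rightarrow> complex" and \<Delta> :: "complex set"
    and \<sigma> z :: complex and \<mu> :: real
  assumes "disc_semigroup \<phi>"
    and "\<not> disc_group \<phi>"
    and "hyperbolic_petal \<phi> \<Delta>"
    and "repelling_fixed_point \<phi> \<sigma>"
    and "corresponds_to \<phi> \<Delta> \<sigma>"
    and "repelling_spectral_value \<phi> \<sigma> \<mu>"
    and "z \<in> \<Delta>"
  shows "((\<lambda>t. total_speed \<phi> \<Delta> z t / t) \<longlongrightarrow> \<mu> / 2) at_bot"
proof -
  note sg = assms(1) and z = assms(7)
  have pt: "petal \<phi> \<Delta>"
    using assms(3) by (simp add: hyperbolic_petal_def)
  have \<sigma>: "cmod \<sigma> = 1"
    using assms(4)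
    by (simp add: repelling_fixed_point_def regular_boundary_fixed_point_def boundary_fixed_point_def)
  obtain \<delta> where \<delta>: "0 < \<delta>"
      "\<And>s x. 0 \<le> s \<Longrightarrow> s \<le> \<delta> \<Longrightarrow> cmod x < 1 \<Longrightarrow> hyp_dist 0 (\<phi> s x) \<le> hyp_dist 0 x + artanh (1 / 2)"
    using semigroup_small_displacement[OF sg] by blast
  define \<alpha> where "\<alpha> = exp (- \<mu> * \<delta>)"
  have \<alpha>: "1 < \<alpha>" and deriv: "has_angular_deriv_fixed (\<phi> \<delta>) \<sigma> (of_real \<alpha>)"
    using assms(6) \<delta>(1) by (auto simp: repelling_spectral_value_def \<alpha>_def mult_neg_pos)
  define b where "b u = petal_flow \<phi> \<Delta> (- u) z" for u
  have b: "b u \<in> \<Delta>" "cmod (b u) < 1" if "0 \<le> u" for u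
    using petal_flow_backward_mem[OF sg pt that z] petal_norm[OF sg pt] by (auto simp: b_def)
  have b_add: "\<phi> s (b (u + s)) = b u" if "0 \<le> s" "0 \<le> u" for s u
    using semigroup_petal_flow_backward_add[OF sg pt that z] by (simp add: b_def)
  have b_lim: "(b \<longlongrightarrow> \<sigma>) at_top"
    using assms(5) z by (simp add: corresponds_to_def b_def[abs_def] filterlim_at_bot_mirror)
  define w where "w n = b (real n * \<delta>)" for n
  have w: "cmod (w n) < 1" for n
    using b \<delta>(1) by (simp add: w_def)
  have w_Suc: "\<phi> \<delta> (w (Suc n)) = w n" for n
    using b_add[of \<delta> "real n * \<delta>"] \<delta>(1) by (simp add: w_def algebra_simps)
  have "filterlim (\<lambda>n. \<delta> * real n) at_top sequentially"
    using \<delta>(1) by (intro filterlim_tendsto_pos_mult_at_top[OF tendsto_const] filterlim_real_sequentially)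
  from filterlim_compose[OF b_lim this] have w_lim: "w \<longlonglongrightarrow> \<sigma>"
    by (simp add: w_def[abs_def] mult.commute)
  \<comment> \<open>The steps of the sequence are the backward images of the single step from \<open>z\<close> to \<open>b \<delta>\<close>.\<close>
  obtain H where H: "\<And>s. 0 \<le> s \<Longrightarrow> hyp_dist (b s) (petal_flow \<phi> \<Delta> (- s) (b \<delta>)) \<le> H"
    using petal_flow_backward_hyp_dist_bounded[OF sg pt z b(1)[of \<delta>]] \<delta>(1) unfolding b_def by auto
  have step: "hyp_dist (w n) (w (Suc n)) \<le> H" for n
  proof -
    have "\<phi> (real n * \<delta>) (w (Suc n)) = b \<delta>"
      using b_add[of "real n * \<delta>" \<delta>] \<delta>(1) by (simp add: w_def algebra_simps)
    then have "petal_flow \<phi> \<Delta> (- (real n * \<delta>)) (b \<delta>) = w (Suc n)"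
      using b(1)[of "real (Suc n) * \<delta>"] \<delta>(1)
      by (intro petal_flow_backward_eqI[OF sg pt]) (auto simp: w_def)
    then show ?thesis
      using H[of "real n * \<delta>"] \<delta>(1) by (simp add: w_def)
  qed
  have "(\<lambda>n. hyp_dist 0 (w n) / real n) \<longlonglongrightarrow> ln \<alpha> / 2"
    using \<delta>(1) semigroup_holomorphic[OF sg, of \<delta>] semigroup_image[OF sg, of \<delta>]
    by (intro backward_iteration_rate[OF _ _ \<sigma> deriv \<alpha> w w_Suc w_lim step]) auto
  moreover have "\<bar>hyp_dist z (b u) - hyp_dist 0 (w (nat \<lfloor>u / \<delta>\<rfloor>))\<bar> \<le> hyp_dist 0 z + H + artanh (1 / 2)"
    if u: "0 \<le> u" for u
  proof -
    define n where "n = nat \<lfloor>u / \<delta>\<rfloor>"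
    have "0 \<le> u / \<delta>"
      using u \<delta>(1) by simp
    then have "real n \<le> u / \<delta>" "u / \<delta> \<le> real (Suc n)"
      unfolding n_def by linarith+
    then have n: "real n * \<delta> \<le> u" "u \<le> real (Suc n) * \<delta>"
      using \<delta>(1) by (simp_all only: pos_le_divide_eq pos_divide_le_eq)
    then have short: "u - real n * \<delta> \<le> \<delta>" "real (Suc n) * \<delta> - u \<le> \<delta>"
      by (simp_all add: algebra_simps)
    \<comment> \<open>\<open>b u\<close> lies on the trajectory from \<open>w (Suc n)\<close> to \<open>w n\<close>, within time \<open>\<delta>\<close> of both.\<close>
    have "w n = \<phi> (u - real n * \<delta>) (b u)"
      using b_add[of "u - real n * \<delta>" "real n * \<delta>"] n \<delta>(1) by (simp add: w_def)
    then have "hyp_dist 0 (w n) \<le> hyp_dist 0 (b u) + artanh (1 / 2)"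
      using \<delta>(2)[of "u - real n * \<delta>" "b u"] n short b(2)[OF u] by simp
    moreover have "b u = \<phi> (real (Suc n) * \<delta> - u) (w (Suc n))"
      using b_add[of "real (Suc n) * \<delta> - u" u] n u by (simp add: w_def)
    then have "hyp_dist 0 (b u) \<le> hyp_dist 0 (w (Suc n)) + artanh (1 / 2)"
      using \<delta>(2)[of "real (Suc n) * \<delta> - u" "w (Suc n)"] n short w[of "Suc n"] by simp
    moreover have "hyp_dist 0 (w (Suc n)) \<le> hyp_dist 0 (w n) + H"
      using hyp_dist_triangle[of 0 "w n" "w (Suc n)"] step[of n] w[of n] w[of "Suc n"] by simp
    moreover have "hyp_dist z (b u) \<le> hyp_dist 0 z + hyp_dist 0 (b u)"
      using hyp_dist_triangle[of z 0 "b u"] petal_norm[OF sg pt z] b(2)[OF u] by (simp add: hyp_dist_commute)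
    moreover have "hyp_dist 0 (b u) \<le> hyp_dist 0 z + hyp_dist z (b u)"
      using hyp_dist_triangle[of 0 z "b u"] petal_norm[OF sg pt z] b(2)[OF u] by simp
    moreover have "0 \<le> H"
      using step[of 0] hyp_dist_nonneg[OF w w, of 0 "Suc 0"] by linarith
    ultimately show ?thesis
      unfolding n_def[symmetric] by linarith
  qed
  ultimately have "((\<lambda>u. hyp_dist z (b u) / u) \<longlongrightarrow> ln \<alpha> / 2 / \<delta>) at_top"
    by (rule tendsto_rate_of_discrete_rate[OF \<delta>(1)])
  then have "((\<lambda>u. - (hyp_dist z (b u) / u)) \<longlongrightarrow> - (ln \<alpha> / 2 / \<delta>)) at_top"
    by (rule tendsto_minus)
  moreover have "- (ln \<alpha> / 2 / \<delta>) = \<mu> / 2"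
    using \<delta>(1) by (simp add: \<alpha>_def)
  ultimately have "((\<lambda>u. - (hyp_dist z (b u) / u)) \<longlongrightarrow> \<mu> / 2) at_top"
    by (simp only:)
  then show ?thesis
    by (simp add: filterlim_at_bot_mirror total_speed_def b_def)
qed

end
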